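(* Let $k,\ell\in\mathbb N$. If $G$ is a finite graph that has tree-width $<k$ and no geodesic cycle longer than $\ell$, and $G$ is not a forest, then $G$ is $\lfloor\frac32\ell(k-2)\rfloor$-hyperbolic.
   Context: Graphs are simple and undirected. A tree-decomposition of a graph $G=(V,E)$ is a pair $(T,(V_t)_{t\in T})$ of a tree $T$ and a family of vertex sets $V_t\subseteq V$ (its parts), indexed by the nodes of $T$, such that (T1) $V=\bigcup_t V_t$; (T2) for every edge of $G$ some $V_t$ contains both its ends; (T3) $V_{t_1}\cap V_{t_3}\subseteq V_{t_2}$ whenever $t_2$ lies on the path between $t_1$ and $t_3$ in $T$. Its width is $\max_t|V_t|-1$, and the tree-width of $G$ is the minimum width of a tree-decomposition of $G$. A subgraph $H\subseteq G$ is geodesic if $d_H(x,y)=d_G(x,y)$ for all vertices $x,y$ of $H$, where $d$ denotes the length (number of edges) of a shortest path in the respective graph. A geodesic cycle is a cycle in $G$ that is a geodesic subgraph. Given a real number $d\ge0$, a graph $G$ is $d$-hyperbolic if whenever vertices $x,y,z$ are linked by shortest paths $P_{xy}=x\dots y$, $P_{yz}=y\dots z$ and $P_{xz}=x\dots z$ in $G$, each of these paths lies within distance $d$ of the other two, i.e. every vertex of each of the three paths has distance (in $G$) at most $d$ from some vertex of the union of the other two paths. *)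

theory Defs
  imports Complex_Main "HOL-Library.Extended_Real"
begin

record 'a graph =
  vertices :: "'a set"
  edges :: "'a set set"

definition simple_graph :: "'a graph \<Rightarrow> bool" where
  "simple_graph G \<longleftrightarrow>
     (\<forall>e\<in>edges G. \<exists>x y. e = {x, y} \<and> x \<noteq> y \<and> x \<in> vertices G \<and> y \<in> vertices G)"

definition subgraph :: "'a graph \<Rightarrow> 'a graph \<Rightarrow> bool" where
  "subgraph H G \<longleftrightarrow> simple_graph H \<and> vertices H \<subseteq> vertices G \<and> edges H \<subseteq> edges G"

text \<open>A path is given by its list of vertices, so its length is one less than that of the list.\<close>

definition path_between :: "'a graph \<Rightarrow> 'a \<Rightarrow> 'a list \<Rightarrow> 'a \<Rightarrow> bool" where
  "path_between G x p y \<longleftrightarrow>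
     p \<noteq> [] \<and> hd p = x \<and> last p = y \<and> distinct p \<and> set p \<subseteq> vertices G \<and>
     successively (\<lambda>u v. {u, v} \<in> edges G) p"

definition path_length :: "'a list \<Rightarrow> nat" where
  "path_length p = length p - 1"

text \<open>The distance of vertices in different components is \<open>\<infinity>\<close>, the infimum of the empty set.\<close>

definition graph_dist :: "'a graph \<Rightarrow> 'a \<Rightarrow> 'a \<Rightarrow> enat" where
  "graph_dist G x y = (INF p \<in> {p. path_between G x p y}. enat (path_length p))"

definition shortest_path :: "'a graph \<Rightarrow> 'a \<Rightarrow> 'a list \<Rightarrow> 'a \<Rightarrow> bool" where
  "shortest_path G x p y \<longleftrightarrow> path_between G x p y \<and> enat (path_length p) = graph_dist G x y"

definition geodesic_subgraph :: "'a graph \<Rightarrow> 'a graph \<Rightarrow> bool" where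
  "geodesic_subgraph H G \<longleftrightarrow>
     subgraph H G \<and> (\<forall>x\<in>vertices H. \<forall>y\<in>vertices H. graph_dist H x y = graph_dist G x y)"

definition is_cycle :: "'a graph \<Rightarrow> bool" where
  "is_cycle C \<longleftrightarrow>
     (\<exists>xs. distinct xs \<and> length xs \<ge> 3 \<and> vertices C = set xs \<and>
           edges C = {{xs ! i, xs ! (Suc i mod length xs)} | i. i < length xs})"

definition cycle_length :: "'a graph \<Rightarrow> nat" where
  "cycle_length C = card (edges C)"

definition geodesic_cycle :: "'a graph \<Rightarrow> 'a graph \<Rightarrow> bool" where
  "geodesic_cycle C G \<longleftrightarrow> is_cycle C \<and> geodesic_subgraph C G"

definition forest :: "'a graph \<Rightarrow> bool" where
  "forest G \<longleftrightarrow> simple_graph G \<and> \<not> (\<exists>C. is_cycle C \<and> subgraph C G)"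

definition connected_graph :: "'a graph \<Rightarrow> bool" where
  "connected_graph G \<longleftrightarrow>
     vertices G \<noteq> {} \<and> (\<forall>x\<in>vertices G. \<forall>y\<in>vertices G. \<exists>p. path_between G x p y)"

definition tree :: "'a graph \<Rightarrow> bool" where
  "tree T \<longleftrightarrow> forest T \<and> connected_graph T"

definition tree_decomposition :: "'a graph \<Rightarrow> 't graph \<Rightarrow> ('t \<Rightarrow> 'a set) \<Rightarrow> bool" where
  "tree_decomposition G T W \<longleftrightarrow>
     tree T \<and>
     vertices G = (\<Union>t\<in>vertices T. W t) \<and>
     (\<forall>e\<in>edges G. \<exists>t\<in>vertices T. e \<subseteq> W t) \<and>
     (\<forall>t1 t2 t3 p. path_between T t1 p t3 \<and> t2 \<in> set p \<longrightarrow> W t1 \<inter> W t3 \<subseteq> W t2)"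

text \<open>
  Widths are integers because the empty graph has tree-width \<open>-1\<close>. The maximum is meaningful
  whenever the decomposed graph is finite, even if the tree is not.
\<close>

definition width :: "'t graph \<Rightarrow> ('t \<Rightarrow> 'a set) \<Rightarrow> int" where
  "width T W = Max ((\<lambda>t. int (card (W t))) ` vertices T) - 1"

text \<open>
  Only for finite graphs. The nodes of the decomposition trees are taken from \<open>nat\<close>: a
  tree-decomposition of a finite graph over any tree restricts, without increasing the width,
  to one over a finite subtree, so this does not affect the minimum.
\<close>

definition tree_width :: "'a graph \<Rightarrow> int" where
  "tree_width G =
     (LEAST w. \<exists>(T :: nat graph) W. tree_decomposition G T W \<and> w = width T W)"

definition within_dist :: "'a graph \<Rightarrow> real \<Rightarrow> 'a set \<Rightarrow> 'a set \<Rightarrow> bool" where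
  "within_dist G d A B \<longleftrightarrow> (\<forall>u\<in>A. \<exists>v\<in>B. ereal_of_enat (graph_dist G u v) \<le> ereal d)"

definition hyperbolic :: "real \<Rightarrow> 'a graph \<Rightarrow> bool" where
  "hyperbolic d G \<longleftrightarrow>
     0 \<le> d \<and>
     (\<forall>x y z P Q R.
        shortest_path G x P y \<and> shortest_path G y Q z \<and> shortest_path G x R z \<longrightarrow>
        within_dist G d (set P) (set Q \<union> set R) \<and>
        within_dist G d (set Q) (set P \<union> set R) \<and>
        within_dist G d (set R) (set P \<union> set Q))"

end

theory Submission
  imports Defs
begin

text \<open>
  Call two vertices near if their distance is at most \<open>m = l div 2\<close>. Split every part of a
  tree-decomposition of width less than \<open>k\<close> into its components with respect to nearness, and join
  two components from adjacent parts if they meet. The resulting graph on the components is a forest: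
  a cycle through one of its edges would yield a closed walk in \<open>G\<close> that passes an odd number of
  times from that edge's intersection \<open>Z\<close> to the far side of the adhesion set. A shortest such
  closed walk is a geodesic cycle, so all its vertices are near each other; but then it meets the
  adhesion set either only inside or only outside \<open>Z\<close>, and the number of passages is even.

  So \<open>G\<close> has a decomposition over a forest into parts of diameter at most \<open>(k - 1) * m\<close>. Given \<open>u\<close> on
  one side of a geodesic triangle, the Helly property of subtrees yields a part that meets this side
  before \<open>u\<close>, this side after \<open>u\<close>, and the union of the two other sides, hence a point of that union
  at distance at most \<open>3 / 2 * (k - 1) * m\<close> from \<open>u\<close>. Since \<open>G\<close> is not a forest, \<open>k \<ge> 3\<close> and so
  \<open>k - 1 \<le> 2 * (k - 2)\<close>.
\<close>

section \<open>Powers of relations and distances\<close>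

lemma relpow_segment:
  assumes "\<And>i. i < n \<Longrightarrow> (f i, f (Suc i)) \<in> R" "i \<le> j" "j \<le> n"
  shows "(f i, f j) \<in> R ^^ (j - i)"
  unfolding relpow_fun_conv
  using assms by (intro exI[of _ "\<lambda>k. f (i + k)"]) auto

lemma sym_relpow: "sym R \<Longrightarrow> sym (R ^^ n)"
proof (induction n)
  case 0
  then show ?case by (simp add: sym_Id)
next
  case (Suc n)
  show ?case
  proof (rule symI)
    fix x y assume "(x, y) \<in> R ^^ Suc n"
    then obtain z where "(x, z) \<in> R ^^ n" "(z, y) \<in> R" by auto
    then have "(y, z) \<in> R" "(z, x) \<in> R ^^ n" using Suc by (auto dest: symD)
    then show "(y, x) \<in> R ^^ Suc n" by (rule relpow_Suc_I2)
  qed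
qed

lemma relpow_relpow: "((R :: 'a rel) ^^ m) ^^ n = R ^^ (m * n)"
proof (induction n)
  case (Suc n)
  have "R ^^ (m * Suc n) = R ^^ (m * n) O R ^^ m"
    unfolding mult_Suc_right by (subst add.commute) (rule relpow_add)
  also have "\<dots> = (R ^^ m) ^^ Suc n" using Suc by simp
  finally show ?case by (rule sym)
qed simp

lemma relpow_trans_add: "(x, y) \<in> R ^^ m \<Longrightarrow> (y, z) \<in> R ^^ n \<Longrightarrow> (x, z) \<in> R ^^ (m + n)"
  by (auto simp: relpow_add)

text \<open>A walk in the reflexive closure may stand still, so powers of \<open>R\<^sup>=\<close>
  express distance at most \<open>n\<close>, whereas powers of \<open>R\<close> fix the exact length
  of a walk.\<close>

lemma relpow_reflcl_mono: "m \<le> n \<Longrightarrow> (x, y) \<in> (R\<^sup>=) ^^ m \<Longrightarrow> (x, y) \<in> (R\<^sup>=) ^^ n"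
proof (induction n rule: dec_induct)
  case (step n)
  then have "(x, y) \<in> (R\<^sup>=) ^^ n" by blast
  then show ?case by auto
qed

lemma relpow_imp_reflcl: "(x, y) \<in> R ^^ n \<Longrightarrow> (x, y) \<in> (R\<^sup>=) ^^ n"
  by (auto simp: relpow_fun_conv)

lemma reflcl_relpow_imp_distinct:
  assumes "(a, b) \<in> (R\<^sup>=) ^^ n"
  shows "\<exists>p. p \<noteq> [] \<and> hd p = a \<and> last p = b \<and> distinct p \<and>
             successively (\<lambda>u v. (u, v) \<in> R) p \<and> length p \<le> Suc n"
  using assms
proof (induction n arbitrary: a)
  case 0
  then show ?case by (intro exI[of _ "[a]"]) auto
next
  case (Suc n)
  obtain c where c: "(a, c) \<in> R\<^sup>=" "(c, b) \<in> (R\<^sup>=) ^^ n"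
    using Suc.prems by (meson relpow_Suc_D2)
  obtain p where p: "p \<noteq> []" "hd p = c" "last p = b" "distinct p"
      "successively (\<lambda>u v. (u, v) \<in> R) p" "length p \<le> Suc n"
    using Suc.IH[OF c(2)] by blast
  show ?case
  proof (cases "a \<in> set p")
    case True
    then obtain xs ys where "p = xs @ a # ys" by (meson split_list)
    then show ?thesis using p
      by (intro exI[of _ "a # ys"]) (auto simp: successively_append_iff)
  next
    case False
    then have "(a, c) \<in> R" using c(1) p(1,2) by (metis UnE hd_in_set pair_in_Id_conv)
    then show ?thesis using p False
      by (intro exI[of _ "a # p"]) (cases p; auto)
  qed
qed

lemma rtrancl_imp_distinct:
  assumes "(a, b) \<in> R\<^sup>*"
  shows "\<exists>p. p \<noteq> [] \<and> hd p = a \<and> last p = b \<and> distinct p \<and> successively (\<lambda>u v. (u, v) \<in> R) p"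
proof -
  obtain n where "(a, b) \<in> R ^^ n" using rtrancl_imp_relpow[OF assms] by blast
  from reflcl_relpow_imp_distinct[OF relpow_imp_reflcl[OF this]] show ?thesis by blast
qed

lemma successively_imp_relpow:
  assumes "successively (\<lambda>u v. (u, v) \<in> R) p" "p \<noteq> []"
  shows "(hd p, last p) \<in> R ^^ (length p - 1)"
proof -
  have "(p ! 0, p ! (length p - 1)) \<in> R ^^ (length p - 1 - 0)"
    by (rule relpow_segment[where n = "length p - 1"])
       (use assms in \<open>auto simp: successively_conv_nth\<close>)
  then show ?thesis using assms by (simp add: hd_conv_nth last_conv_nth)
qed

section \<open>Walks in graphs as powers of the adjacency relation\<close>

definition adj :: "'a graph \<Rightarrow> 'a rel" where
  "adj G = {(u, v). {u, v} \<in> edges G}"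

lemma sym_adj: "sym (adj G)"
  by (auto simp: adj_def sym_def insert_commute)

lemma adj_relpow_sym: "(x, y) \<in> adj G ^^ n \<Longrightarrow> (y, x) \<in> adj G ^^ n"
  using sym_relpow[OF sym_adj] by (rule symD)

lemma adj_vertices: "simple_graph G \<Longrightarrow> (u, v) \<in> adj G \<Longrightarrow> u \<in> vertices G \<and> v \<in> vertices G \<and> u \<noteq> v"
  by (fastforce simp: adj_def simple_graph_def doubleton_eq_iff)

lemma path_between_iff_adj:
  "path_between G x p y \<longleftrightarrow> p \<noteq> [] \<and> hd p = x \<and> last p = y \<and> distinct p \<and> set p \<subseteq> vertices G \<and>
     successively (\<lambda>u v. (u, v) \<in> adj G) p"
  by (simp add: path_between_def adj_def)

lemma successively_adj_vertices:
  assumes "simple_graph G" "successively (\<lambda>u v. (u, v) \<in> adj G) p" "p \<noteq> []" "hd p \<in> vertices G"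
  shows "set p \<subseteq> vertices G"
  using assms(2-4)
proof (induction p)
  case (Cons a p)
  then show ?case using adj_vertices[OF assms(1)] by (cases p) auto
qed simp

lemma graph_dist_le:
  assumes "simple_graph G" "x \<in> vertices G" "(x, y) \<in> ((adj G)\<^sup>=) ^^ n"
  shows "graph_dist G x y \<le> enat n"
proof -
  obtain p where p: "p \<noteq> []" "hd p = x" "last p = y" "distinct p"
      "successively (\<lambda>u v. (u, v) \<in> adj G) p" "length p \<le> Suc n"
    using reflcl_relpow_imp_distinct[OF assms(3)] by blast
  have "path_between G x p y"
    using p successively_adj_vertices[OF assms(1) p(5,1)] assms(2) by (simp add: path_between_iff_adj)
  then have "graph_dist G x y \<le> enat (path_length p)"
    unfolding graph_dist_def by (intro INF_lower) simp
  also have "\<dots> \<le> enat n" using p(6) by (simp add: path_length_def)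
  finally show ?thesis .
qed

lemma graph_dist_ge:
  assumes "\<And>q. (x, y) \<in> adj G ^^ q \<Longrightarrow> n \<le> q"
  shows "enat n \<le> graph_dist G x y"
  unfolding graph_dist_def
proof (rule INF_greatest)
  fix p assume "p \<in> {p. path_between G x p y}"
  then show "enat n \<le> enat (path_length p)"
    using assms successively_imp_relpow[of "adj G" p] by (auto simp: path_between_iff_adj path_length_def)
qed

section \<open>Decompositions over forests\<close>

text \<open>The empty set counts as connected, so the condition in \<open>forest_dec\<close> can
  range over all \<open>v\<close> of the type, including those in no part.\<close>

definition conn :: "'n rel \<Rightarrow> 'n set \<Rightarrow> bool" where
  "conn R S \<longleftrightarrow> (\<forall>x\<in>S. \<forall>y\<in>S. (x, y) \<in> (Restr R S)\<^sup>*)"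

text \<open>
  Acyclicity is expressed by cuts: every edge is a bridge, witnessed by a two-colouring that changes
  only along this edge.
\<close>

definition bridged :: "'n rel \<Rightarrow> bool" where
  "bridged R \<longleftrightarrow> (\<forall>x y. (x, y) \<in> R \<longrightarrow>
     (\<exists>g :: 'n \<Rightarrow> bool. g x \<noteq> g y \<and> (\<forall>u v. (u, v) \<in> R \<longrightarrow> g u \<noteq> g v \<longrightarrow> {u, v} = {x, y})))"

lemma rtrancl_invariant:
  assumes "(x, y) \<in> R\<^sup>*" "\<And>u v. (u, v) \<in> R \<Longrightarrow> g u = g v"
  shows "g x = g y"
  using assms by (induction rule: rtrancl_induct) auto

text \<open>
  Take a shortest walk inside \<open>A\<close> from \<open>A \<inter> B\<close> to \<open>A \<inter> C\<close>. If it had a first edge, this edge would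
  be used neither by the rest of the walk nor inside \<open>B\<close> nor inside \<open>C\<close>, so it would not be a bridge.
\<close>

lemma bridged_Helly:
  assumes R: "bridged R" and c: "conn R A" "conn R B" "conn R C"
    and ne: "A \<inter> B \<noteq> {}" "B \<inter> C \<noteq> {}" "A \<inter> C \<noteq> {}"
  shows "A \<inter> B \<inter> C \<noteq> {}"
proof -
  define Q where "Q n \<longleftrightarrow> (\<exists>h\<in>A \<inter> B. \<exists>h0\<in>A \<inter> C. (h, h0) \<in> (Restr R A) ^^ n)" for n
  have "\<exists>n. Q n"
    using ne(1,3) c(1) unfolding conn_def Q_def by (blast dest: rtrancl_imp_relpow)
  then obtain n where n: "Q n" and min: "\<And>j. j < n \<Longrightarrow> \<not> Q j"
    using exists_least_iff[of Q] by blast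
  obtain h h0 where h: "h \<in> A \<inter> B" "h0 \<in> A \<inter> C" "(h, h0) \<in> (Restr R A) ^^ n"
    using n unfolding Q_def by blast
  show ?thesis
  proof (cases n)
    case 0
    then show ?thesis using h by auto
  next
    case (Suc m)
    obtain h' where h': "(h, h') \<in> Restr R A" "(h', h0) \<in> (Restr R A) ^^ m"
      using h(3) unfolding Suc by (meson relpow_Suc_D2)
    have "h' \<notin> B" using min[of m] h(2) h' Suc unfolding Q_def by blast
    have "h \<notin> C"
    proof
      assume "h \<in> C"
      then have "Q 0" unfolding Q_def using h(1) by (intro bexI[of _ h]) auto
      then show False using min[of 0] Suc by simp
    qed
    obtain g :: "_ \<Rightarrow> bool" where g: "g h \<noteq> g h'"
        "\<And>u v. (u, v) \<in> R \<Longrightarrow> g u \<noteq> g v \<Longrightarrow> {u, v} = {h, h'}"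
      using R[unfolded bridged_def, rule_format, of h h'] h'(1) by auto
    \<comment> \<open>The rest of the walk cannot return to \<open>h\<close>: from there on it would
      be a shorter walk of the kind minimised.\<close>
    have far: "(h, h0) \<notin> (Restr R A) ^^ j" if "j \<le> m" for j
    proof
      assume "(h, h0) \<in> (Restr R A) ^^ j"
      then have "Q j" unfolding Q_def using h(1,2) by (intro bexI[of _ h] bexI[of _ h0])
      then show False using min[of j] that Suc by simp
    qed
    have "g x = g h0" if "(x, h0) \<in> (Restr R A) ^^ j" "j \<le> m" for x j
      using that
    proof (induction j arbitrary: x)
      case (Suc j)
      obtain y where y: "(x, y) \<in> Restr R A" "(y, h0) \<in> (Restr R A) ^^ j"
        using Suc.prems(1) by (meson relpow_Suc_D2)
      have "x \<noteq> h" "y \<noteq> h" using far[of "Suc j"] far[of j] Suc.prems y(2) by auto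
      then have "g x = g y" using g(2)[of x y] y(1) by blast
      then show ?case using Suc.IH[OF y(2)] Suc.prems by simp
    qed simp
    then have "g h' = g h0" using h'(2) by blast
    moreover have g_eq: "g u = g v" if "(u, v) \<in> Restr R S" "h \<notin> S \<or> h' \<notin> S" for u v S
      using g(2)[of u v] that by (auto simp: doubleton_eq_iff)
    \<comment> \<open>The colour \<open>g\<close> does not change within \<open>B\<close>, which
      misses \<open>h'\<close>, nor within \<open>C\<close>, which misses \<open>h\<close>. So
      \<open>h\<close>, \<open>h2\<close>, \<open>h0\<close> and \<open>h'\<close> all have the same
      colour.\<close>
    obtain h2 where h2: "h2 \<in> B" "h2 \<in> C" using ne(2) by blast
    have "g h = g h2"
    proof (rule rtrancl_invariant[where g = g and R = "Restr R B"])
      show "(h, h2) \<in> (Restr R B)\<^sup>*" using c(2) h(1) h2 by (simp add: conn_def)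
    qed (use g_eq \<open>h' \<notin> B\<close> in blast)
    moreover have "g h2 = g h0"
    proof (rule rtrancl_invariant[where g = g and R = "Restr R C"])
      show "(h2, h0) \<in> (Restr R C)\<^sup>*" using c(3) h(2) h2 by (simp add: conn_def)
    qed (use g_eq \<open>h \<notin> C\<close> in blast)
    ultimately show ?thesis using g(1) by simp
  qed
qed

text \<open>The nodes are all elements of a type, with empty parts allowed, and they only have to
  form a forest: splitting the parts of a tree-decomposition leaves isolated nodes with empty
  part.\<close>

definition forest_dec :: "'a set \<Rightarrow> 'a rel \<Rightarrow> 'n rel \<Rightarrow> ('n \<Rightarrow> 'a set) \<Rightarrow> bool" where
  "forest_dec V E R P \<longleftrightarrow> bridged R \<and> (\<forall>v. conn R {n. v \<in> P n}) \<and>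
     (\<forall>v\<in>V. \<exists>n. v \<in> P n) \<and> (\<forall>u v. (u, v) \<in> E \<longrightarrow> (\<exists>n. u \<in> P n \<and> v \<in> P n))"

text \<open>The ends of an edge share a part and the nodes of a single vertex are connected, so a
  walk in \<open>S\<close> can be followed by a walk through nodes that touch
  \<open>S\<close>.\<close>

lemma conn_touching:
  assumes "forest_dec V E R P" "conn E S"
  shows "conn R {n. P n \<inter> S \<noteq> {}}"
proof -
  let ?N = "{n. P n \<inter> S \<noteq> {}}"
  have one: "(a, b) \<in> (Restr R ?N)\<^sup>*" if "v \<in> S" "v \<in> P a" "v \<in> P b" for v a b
  proof -
    have "(a, b) \<in> (Restr R {n. v \<in> P n})\<^sup>*"
      using assms(1) that unfolding forest_dec_def conn_def by blast
    then show ?thesis by (rule rtrancl_mono[THEN subsetD, rotated]) (use that in blast)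
  qed
  \<comment> \<open>The claim covers all nodes \<open>b\<close> of the current vertex, because the
    part containing the next edge need not be the one reached so far.\<close>
  have steps: "\<forall>b. v \<in> P b \<longrightarrow> (a, b) \<in> (Restr R ?N)\<^sup>*" if "u \<in> P a" "u \<in> S" "(u, v) \<in> (Restr E S)\<^sup>*" for u v a
    using that(3)
  proof (induction rule: rtrancl_induct)
    case base
    then show ?case using one that by blast
  next
    case (step y z)
    obtain n where n: "y \<in> P n" "z \<in> P n" using assms(1) step.hyps unfolding forest_dec_def by blast
    have "z \<in> S" using step.hyps by blast
    show ?case
    proof (intro allI impI)
      fix b assume "z \<in> P b"
      then show "(a, b) \<in> (Restr R ?N)\<^sup>*"
        using step.IH n one[OF \<open>z \<in> S\<close> n(2)] by (blast intro: rtrancl_trans)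
    qed
  qed
  show ?thesis unfolding conn_def
  proof (intro ballI)
    fix a b assume "a \<in> ?N" "b \<in> ?N"
    then obtain u v where "u \<in> P a" "u \<in> S" "v \<in> P b" "v \<in> S" by blast
    then show "(a, b) \<in> (Restr R ?N)\<^sup>*" using steps[of u a v] assms(2) by (simp add: conn_def)
  qed
qed

lemma forest_dec_Helly:
  assumes "forest_dec V E R P" "conn E A" "conn E B" "conn E C"
    and "\<exists>n. P n \<inter> A \<noteq> {} \<and> P n \<inter> B \<noteq> {}" "\<exists>n. P n \<inter> B \<noteq> {} \<and> P n \<inter> C \<noteq> {}"
        "\<exists>n. P n \<inter> A \<noteq> {} \<and> P n \<inter> C \<noteq> {}"
  shows "\<exists>n. P n \<inter> A \<noteq> {} \<and> P n \<inter> B \<noteq> {} \<and> P n \<inter> C \<noteq> {}"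
  using bridged_Helly[OF _ conn_touching[OF assms(1,2)] conn_touching[OF assms(1,3)]
      conn_touching[OF assms(1,4)]] assms(1,5-7)
  unfolding forest_dec_def by blast

section \<open>Tree-decompositions as forest decompositions\<close>

text \<open>The vertices are coloured by reachability from \<open>s\<close> after deletion of the
  edge \<open>st\<close>. If \<open>t\<close> were still reachable, a path to it would close up with
  \<open>st\<close> to a cycle.\<close>

lemma forest_bridged:
  fixes T :: "'a graph"
  assumes "forest T"
  shows "bridged (adj T)"
  unfolding bridged_def
proof (intro allI impI)
  fix s t assume st: "(s, t) \<in> adj T"
  let ?R = "adj T - {(s, t), (t, s)}"
  have T: "simple_graph T" using assms by (simp add: forest_def)
  have sep: "(s, t) \<notin> ?R\<^sup>*"
  proof
    assume "(s, t) \<in> ?R\<^sup>*"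
    then obtain p where p: "p \<noteq> []" "hd p = s" "last p = t" "distinct p"
        "successively (\<lambda>u v. (u, v) \<in> ?R) p"
      using rtrancl_imp_distinct by metis
    have "s \<noteq> t" using adj_vertices[OF T st] by simp
    \<comment> \<open>One vertex would mean \<open>s = t\<close>, and two would mean that the path
      is the deleted edge.\<close>
    have len: "length p \<ge> 3"
    proof (rule ccontr)
      assume "\<not> 3 \<le> length p"
      then consider a where "p = [a]" | a b where "p = [a, b]" using p(1)
        by (cases p rule: remdups_adj.cases; cases "tl (tl p)") auto
      then show False using p \<open>s \<noteq> t\<close> by cases auto
    qed
    have pT: "successively (\<lambda>u v. (u, v) \<in> adj T) p"
      by (rule successively_mono[OF p(5)]) auto
    define C where "C = \<lparr>vertices = set p, edges = {{p ! i, p ! (Suc i mod length p)} | i. i < length p}\<rparr>"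
    have "is_cycle C" unfolding is_cycle_def C_def using p(4) len by (intro exI[of _ p]) auto
    moreover have V: "set p \<subseteq> vertices T"
      using successively_adj_vertices[OF T pT p(1)] p(2) adj_vertices[OF T st] by simp
    have E: "(p ! i, p ! (Suc i mod length p)) \<in> adj T" if "i < length p" for i
    proof (cases "Suc i < length p")
      case True
      then show ?thesis using pT by (auto simp: successively_conv_nth)
    next
      case False
      then have "Suc i = length p" using that by simp
      then have "p ! i = t" "p ! (Suc i mod length p) = s"
        using p(1-3) by (auto simp: last_conv_nth hd_conv_nth simp flip: \<open>Suc i = length p\<close>)
      then show ?thesis using st sym_adj[of T] by (simp add: symD)
    qed
    have "subgraph C T" unfolding subgraph_def
    proof (intro conjI)
      show "edges C \<subseteq> edges T" using E by (auto simp: C_def adj_def)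
      show "vertices C \<subseteq> vertices T" using V by (simp add: C_def)
      have "p ! i \<in> set p \<and> p ! (Suc i mod length p) \<in> set p" if "i < length p" for i
        using that p(1) by (intro conjI nth_mem) auto
      then show "simple_graph C" using E adj_vertices[OF T] unfolding simple_graph_def C_def by fastforce
    qed
    ultimately show False using assms unfolding forest_def by blast
  qed
  have "sym ?R" using sym_adj[of T] by (auto simp: sym_def)
  then have step: "(s, u) \<in> ?R\<^sup>* \<longleftrightarrow> (s, v) \<in> ?R\<^sup>*" if "(u, v) \<in> ?R" for u v
    using that by (meson rtrancl.rtrancl_into_rtrancl symD)
  have cut: "{u, v} = {s, t}" if "(u, v) \<in> adj T" "((s, u) \<in> ?R\<^sup>*) \<noteq> ((s, v) \<in> ?R\<^sup>*)" for u v
  proof -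
    have "(u, v) \<notin> ?R" using that(2) step by blast
    then show ?thesis using that(1) by auto
  qed
  show "\<exists>g :: 'a \<Rightarrow> bool. g s \<noteq> g t \<and> (\<forall>u v. (u, v) \<in> adj T \<longrightarrow> g u \<noteq> g v \<longrightarrow> {u, v} = {s, t})"
  proof (intro exI[of _ "\<lambda>u. (s, u) \<in> ?R\<^sup>*"] conjI allI impI)
    show "((s, s) \<in> ?R\<^sup>*) \<noteq> ((s, t) \<in> ?R\<^sup>*)" using sep by simp
  qed (rule cut)
qed

text \<open>Condition (T3) keeps the tree path between two nodes of \<open>v\<close> inside the set
  of nodes of \<open>v\<close>. Elements of the node type outside \<open>T\<close> get the empty
  part.\<close>

lemma tree_decomposition_forest_dec:
  assumes "tree_decomposition G T W"
  shows "forest_dec (vertices G) (adj G) (adj T) (\<lambda>t. if t \<in> vertices T then W t else {})"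
    (is "forest_dec _ _ _ ?W")
  unfolding forest_dec_def
proof (intro conjI allI ballI impI)
  have "tree T"
    and cover: "vertices G = (\<Union>t\<in>vertices T. W t)" "\<forall>e\<in>edges G. \<exists>t\<in>vertices T. e \<subseteq> W t"
    and "\<forall>a c b p. path_between T a p b \<and> c \<in> set p \<longrightarrow> W a \<inter> W b \<subseteq> W c"
    using assms unfolding tree_decomposition_def by - (elim conjE; assumption)+
  note between = this(4)[rule_format, OF conjI]
  show "bridged (adj T)" using \<open>tree T\<close> forest_bridged by (auto simp: tree_def)
  show "conn (adj T) {t. v \<in> ?W t}" for v
    unfolding conn_def
  proof (intro ballI)
    fix a b assume ab: "a \<in> {t. v \<in> ?W t}" "b \<in> {t. v \<in> ?W t}"
    then have "a \<in> vertices T" "b \<in> vertices T" by (auto split: if_splits)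
    then obtain p where p: "path_between T a p b"
      using \<open>tree T\<close> unfolding tree_def connected_graph_def by blast
    have in_S: "set p \<subseteq> {t. v \<in> ?W t}"
    proof
      fix c assume "c \<in> set p"
      then have "W a \<inter> W b \<subseteq> W c" using between[OF p] by blast
      moreover have "c \<in> vertices T" using \<open>c \<in> set p\<close> p by (auto simp: path_between_def)
      ultimately show "c \<in> {t. v \<in> ?W t}" using ab by (auto split: if_splits)
    qed
    have p': "p \<noteq> []" "hd p = a" "last p = b" "successively (\<lambda>x y. (x, y) \<in> adj T) p"
      using p by (simp_all add: path_between_iff_adj)
    have "successively (\<lambda>x y. (x, y) \<in> Restr (adj T) {t. v \<in> ?W t}) p"
    proof (rule successively_mono[OF p'(4)])
      fix x y assume "x \<in> set p" "y \<in> set p" "(x, y) \<in> adj T"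
      then show "(x, y) \<in> Restr (adj T) {t. v \<in> ?W t}" using in_S by blast
    qed
    from successively_imp_relpow[OF this p'(1)] show "(a, b) \<in> (Restr (adj T) {t. v \<in> ?W t})\<^sup>*"
      unfolding p'(2,3) by (rule relpow_imp_rtrancl)
  qed
  show "\<exists>t. v \<in> ?W t" if "v \<in> vertices G" for v
    using cover(1) that by auto
  show "\<exists>t. u \<in> ?W t \<and> v \<in> ?W t" if "(u, v) \<in> adj G" for u v
  proof -
    have "\<exists>t\<in>vertices T. {u, v} \<subseteq> W t" using bspec[OF cover(2), of "{u, v}"] that by (simp add: adj_def)
    then show ?thesis by auto
  qed
qed

section \<open>Splitting parts into components of near vertices\<close>

text \<open>Nearness is measured in the whole graph: only the ends of each walk of length at most
  \<open>m\<close> must lie in \<open>X\<close>, not its inner vertices.\<close>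

definition near_class :: "'a rel \<Rightarrow> nat \<Rightarrow> 'a set \<Rightarrow> 'a \<Rightarrow> 'a set" where
  "near_class E m X v = (Restr ((E\<^sup>=) ^^ m) X)\<^sup>* `` {v}"

text \<open>\<open>Y\<close> serves as the name of a component; if no component of
  \<open>W t\<close> is \<open>Y\<close>, the part is empty.\<close>

definition refined_part :: "'a rel \<Rightarrow> nat \<Rightarrow> ('n \<Rightarrow> 'a set) \<Rightarrow> 'n \<times> 'a set \<Rightarrow> 'a set" where
  "refined_part E m W = (\<lambda>(t, Y). {v \<in> W t. near_class E m (W t) v = Y})"

definition refined_rel :: "'a rel \<Rightarrow> nat \<Rightarrow> 'n rel \<Rightarrow> ('n \<Rightarrow> 'a set) \<Rightarrow> ('n \<times> 'a set) rel" where
  "refined_rel E m R W =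
     {(a, b). (fst a, fst b) \<in> R \<and> refined_part E m W a \<inter> refined_part E m W b \<noteq> {}}"

text \<open>
  A cohomological form of the absence of long geodesic cycles: a \<open>\<int>/2\<close>-valued function on the edges
  that is a coboundary on every set of diameter at most \<open>m\<close> is a coboundary.
\<close>

definition locally_exact :: "'a rel \<Rightarrow> nat \<Rightarrow> bool" where
  "locally_exact E m \<longleftrightarrow> (\<forall>F. (\<forall>u v. F u v = F v u) \<longrightarrow>
     (\<forall>S. (\<forall>u\<in>S. \<forall>v\<in>S. (u, v) \<in> (E\<^sup>=) ^^ m) \<longrightarrow>
       (\<exists>\<psi> :: 'a \<Rightarrow> bool. \<forall>u\<in>S. \<forall>v\<in>S. (u, v) \<in> E \<longrightarrow> F u v = (\<psi> u \<noteq> \<psi> v))) \<longrightarrow>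
     (\<exists>f :: 'a \<Rightarrow> bool. \<forall>u v. (u, v) \<in> E \<longrightarrow> F u v = (f u \<noteq> f v)))"

lemma sym_Restr: "sym R \<Longrightarrow> sym (Restr R S)"
  by (auto simp: sym_def)

lemma near_class_eq_iff:
  assumes "sym E"
  shows "near_class E m X u = near_class E m X v \<longleftrightarrow> (u, v) \<in> (Restr ((E\<^sup>=) ^^ m) X)\<^sup>*"
proof -
  let ?N = "(Restr ((E\<^sup>=) ^^ m) X)\<^sup>*"
  have "sym (E\<^sup>=)" using assms by (auto simp: sym_def)
  then have s: "sym ?N" by (intro sym_rtrancl sym_Restr sym_relpow)
  show ?thesis
  proof
    assume "near_class E m X u = near_class E m X v"
    then show "(u, v) \<in> ?N" unfolding near_class_def by blast
  next
    assume "(u, v) \<in> ?N"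
    moreover from this have "(v, u) \<in> ?N" using s by (rule symD[rotated])
    ultimately show "near_class E m X u = near_class E m X v"
      unfolding near_class_def by (blast intro: rtrancl_trans)
  qed
qed

lemma near_class_eq:
  assumes "sym E" "(u, v) \<in> (E\<^sup>=) ^^ m" "u \<in> X" "v \<in> X"
  shows "near_class E m X u = near_class E m X v"
  using assms by (auto simp: near_class_eq_iff)

text \<open>The nodes containing \<open>v\<close> form a connected set in which both colours occur,
  so this set contains both ends of the only edge at which \<chi> changes.\<close>

lemma forest_dec_crossing:
  assumes "forest_dec V E R W"
    and "\<And>a b. (a, b) \<in> R \<Longrightarrow> \<chi> a \<noteq> \<chi> b \<Longrightarrow> {a, b} = {s, t}"
    and "v \<in> W a" "v \<in> W b" "\<chi> a \<noteq> \<chi> b"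
  shows "v \<in> W s \<inter> W t"
proof (rule ccontr)
  assume v: "v \<notin> W s \<inter> W t"
  have "\<chi> a = \<chi> b"
  proof (rule rtrancl_invariant[where g = \<chi>])
    show "(a, b) \<in> (Restr R {n. v \<in> W n})\<^sup>*"
      using assms(1,3,4) unfolding forest_dec_def conn_def by blast
    show "\<chi> x = \<chi> y" if "(x, y) \<in> Restr R {n. v \<in> W n}" for x y
      using assms(2)[of x y] that v by (auto simp: doubleton_eq_iff)
  qed
  then show False using assms(5) by simp
qed

text \<open>
  Local exactness is applied to the set of edges between \<open>Z\<close> and the vertices strictly beyond the
  adhesion set on the side \<open>\<chi>\<close>.
\<close>

lemma adhesion_cut_potential:
  fixes E :: "'a rel" and \<chi> :: "'n \<Rightarrow> bool"
  assumes fd: "forest_dec V E R W"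
    and cut: "\<And>a b. (a, b) \<in> R \<Longrightarrow> \<chi> a \<noteq> \<chi> b \<Longrightarrow> {a, b} = {s, t}"
    and Z: "Z \<subseteq> W s \<inter> W t"
      "\<And>u v. u \<in> Z \<Longrightarrow> v \<in> W s \<inter> W t \<Longrightarrow> (u, v) \<in> (E\<^sup>=) ^^ m \<Longrightarrow> v \<in> Z"
    and pot: "locally_exact E m"
    and sE: "sym E"
  shows "\<exists>f :: 'a \<Rightarrow> bool. \<forall>n. \<forall>a\<in>W n. \<forall>b\<in>W n. (a, b) \<in> (E\<^sup>=) ^^ m \<longrightarrow>
    f a = f b \<longleftrightarrow> (\<chi> n \<and> a \<in> Z \<longleftrightarrow> \<chi> n \<and> b \<in> Z)"
proof -
  define X where "X = W s \<inter> W t"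
  define B where "B = {v. v \<notin> X \<and> (\<exists>n. \<chi> n \<and> v \<in> W n)}"
  define F where "F u v \<longleftrightarrow> u \<in> Z \<and> v \<in> B \<or> v \<in> Z \<and> u \<in> B" for u v
  have "sym (E\<^sup>=)" using sE by (auto simp: sym_def)
  then have near_sym: "(u, v) \<in> (E\<^sup>=) ^^ m \<Longrightarrow> (v, u) \<in> (E\<^sup>=) ^^ m" for u v
    using sym_relpow by (metis symD)
  have side: "v \<notin> B" if "v \<in> W n" "\<not> \<chi> n" for v n
    using forest_dec_crossing[where \<chi> = \<chi> and v = v and b = n, OF fd cut] that
    unfolding B_def X_def by blast
  have ZB: "v \<notin> B" if "v \<in> Z" for v using that Z(1) unfolding B_def X_def by blast
  \<comment> \<open>An edge with exactly one end in \<open>B\<close> lies in a part on the side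
    \<chi>, so its other end is in the adhesion set \<open>X\<close> and hence in \<open>Z\<close>.
    Thus on such a set \<open>S\<close> the function \<open>F\<close> is the coboundary of
    \<open>B\<close>.\<close>
  have F_inner: "F u v = ((u \<in> B) \<noteq> (v \<in> B))" if S: "S \<inter> X \<subseteq> Z" "u \<in> S" "v \<in> S" "(u, v) \<in> E" for S u v
  proof -
    obtain n where n: "u \<in> W n" "v \<in> W n" using fd S(4) unfolding forest_dec_def by blast
    have Zc: "y \<in> Z" if "x \<in> B" "y \<notin> B" "{x, y} = {u, v}" for x y
    proof -
      have xy: "x \<in> W n" "y \<in> W n" "y \<in> S" using that n S by (auto simp: doubleton_eq_iff)
      then have "\<chi> n" using side that(1) by blast
      then have "y \<in> X" using that(2) xy unfolding B_def by blast
      then show ?thesis using xy S by blast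
    qed
    then show ?thesis using Zc[of u v] Zc[of v u] ZB[of u] ZB[of v] by (auto simp: F_def insert_commute)
  qed
  \<comment> \<open>\<open>Z\<close> is closed under nearness within \<open>X\<close>, so a set of
    pairwise near vertices that meets \<open>Z\<close> has no vertex in \<open>X\<close> outside
    \<open>Z\<close>.\<close>
  have dich: "S \<inter> Z = {} \<or> S \<inter> X \<subseteq> Z" if "\<And>u v. u \<in> S \<Longrightarrow> v \<in> S \<Longrightarrow> (u, v) \<in> (E\<^sup>=) ^^ m" for S
    using that Z(2) unfolding X_def by blast
  have "\<exists>f :: 'a \<Rightarrow> bool. \<forall>u v. (u, v) \<in> E \<longrightarrow> F u v = (f u \<noteq> f v)"
  proof (rule pot[unfolded locally_exact_def, rule_format])
    fix S assume "\<And>u v. u \<in> S \<Longrightarrow> v \<in> S \<Longrightarrow> (u, v) \<in> (E\<^sup>=) ^^ m"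
    then consider "S \<inter> Z = {}" | "S \<inter> X \<subseteq> Z" using dich by blast
    then show "\<exists>\<psi> :: 'a \<Rightarrow> bool. \<forall>u\<in>S. \<forall>v\<in>S. (u, v) \<in> E \<longrightarrow> F u v = (\<psi> u \<noteq> \<psi> v)"
    proof cases
      case 1
      then show ?thesis unfolding F_def by (intro exI[of _ "\<lambda>_. False"]) blast
    next
      case 2
      then show ?thesis using F_inner by (intro exI[of _ "\<lambda>v. v \<in> B"]) blast
    qed
  qed (auto simp: F_def)
  then obtain f :: "'a \<Rightarrow> bool" where f: "\<And>u v. (u, v) \<in> E \<Longrightarrow> F u v = (f u \<noteq> f v)" by blast
  show ?thesis
  proof (intro exI[of _ f] allI ballI impI)
    fix n a b assume a: "a \<in> W n" and b: "b \<in> W n" and ab: "(a, b) \<in> (E\<^sup>=) ^^ m"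
    obtain w where w: "w 0 = a" "w m = b" "\<And>i. i < m \<Longrightarrow> (w i, w (Suc i)) \<in> E\<^sup>="
      using ab unfolding relpow_fun_conv by blast
    \<comment> \<open>The vertices of a walk of length at most \<open>m\<close> are pairwise near,
      so the same dichotomy applies to the walk itself.\<close>
    let ?S = "w ` {..m}"
    have le: "(w i, w j) \<in> (E\<^sup>=) ^^ m" if "i \<le> j" "j \<le> m" for i j
      by (rule relpow_reflcl_mono[OF _ relpow_segment[where n = m]]) (use that w(3) in auto)
    have "(u, v) \<in> (E\<^sup>=) ^^ m" if uv: "u \<in> ?S" "v \<in> ?S" for u v
    proof -
      obtain i j where ij: "u = w i" "v = w j" "i \<le> m" "j \<le> m" using uv by blast
      show ?thesis using le[of i j] le[of j i] near_sym ij by (metis nat_le_linear)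
    qed
    then consider "?S \<inter> Z = {}" | "?S \<inter> X \<subseteq> Z" using dich by blast
    moreover have ends: "a \<in> ?S" "b \<in> ?S" using w(1,2) by force+
    ultimately show "f a = f b \<longleftrightarrow> (\<chi> n \<and> a \<in> Z \<longleftrightarrow> \<chi> n \<and> b \<in> Z)"
    proof cases
      case 1
      have "f (w i) = f a" if "i \<le> m" for i
        using that
      proof (induction i)
        case (Suc i)
        have "w i \<in> ?S" "w (Suc i) \<in> ?S" using Suc.prems by simp_all
        then have "w i \<notin> Z" "w (Suc i) \<notin> Z" using 1 by blast+
        then have "\<not> F (w i) (w (Suc i))" by (simp add: F_def)
        then show ?case using Suc w(3)[of i] f[of "w i" "w (Suc i)"] by auto
      qed (simp add: w)
      then show ?thesis using 1 ends w(2) by auto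
    next
      case 2
      \<comment> \<open>Along the walk \<open>f\<close> equals the indicator of \<open>B\<close> up
        to a constant. In a part on the side \<chi>, a vertex of the walk is in \<open>B\<close>
        exactly if it is not in \<open>Z\<close>; the other parts do not meet
        \<open>B\<close>.\<close>
      have "(f (w i) \<noteq> (w i \<in> B)) = (f a \<noteq> (a \<in> B))" if "i \<le> m" for i
        using that
      proof (induction i)
        case (Suc i)
        have "(w i, w (Suc i)) \<in> E \<Longrightarrow> F (w i) (w (Suc i)) = ((w i \<in> B) \<noteq> (w (Suc i) \<in> B))"
          using F_inner[OF 2] Suc.prems by simp
        then show ?case using Suc w(3)[of i] f[of "w i" "w (Suc i)"] by auto
      qed (simp add: w)
      then have "(f b \<noteq> (b \<in> B)) = (f a \<noteq> (a \<in> B))" using w(2) by blast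
      moreover have "v \<in> B \<longleftrightarrow> v \<notin> Z" if "v \<in> ?S" "v \<in> W n" "\<chi> n" for v
        using that 2 ZB unfolding B_def by blast
      ultimately show ?thesis using side a b ends by blast
    qed
  qed
qed

text \<open>A component is coloured by \<open>f v\<close> for the \<open>f\<close> of
  \<open>adhesion_cut_potential\<close>, flipped if its node is on the chosen side and
  \<open>v\<close> is in \<open>Z\<close>; by the choice of \<open>f\<close>, near vertices of a
  part give the same colour. At a vertex shared by two components \<open>f v\<close> cancels, so the
  colour changes only across the given edge. The bound \<open>m \<ge> 1\<close> keeps the ends of
  each edge of \<open>E\<close> in one component.\<close>

lemma forest_dec_refined:
  fixes E :: "'a rel"
  assumes fd: "forest_dec V E R W" and sE: "sym E" and m: "m \<ge> 1"
    and pot: "locally_exact E m"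
  shows "forest_dec V E (refined_rel E m R W) (refined_part E m W)"
proof -
  let ?c = "\<lambda>t. near_class E m (W t)" and ?P = "refined_part E m W" and ?H = "refined_rel E m R W"
  have mem: "v \<in> ?P (t, Y) \<longleftrightarrow> v \<in> W t \<and> ?c t v = Y" for v t Y
    by (simp add: refined_part_def)
  have "bridged ?H"
    unfolding bridged_def
  proof (intro allI impI)
    fix x y assume xy: "(x, y) \<in> ?H"
    obtain s Y t Y' where eq: "x = (s, Y)" "y = (t, Y')" by (metis surj_pair)
    have st: "(s, t) \<in> R" using xy eq by (simp add: refined_rel_def)
    define Z where "Z = ?P x \<inter> ?P y"
    obtain z where z: "z \<in> Z" using xy unfolding refined_rel_def Z_def by blast
    obtain g :: "_ \<Rightarrow> bool" where g: "g s \<noteq> g t"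
        "\<And>u v. (u, v) \<in> R \<Longrightarrow> g u \<noteq> g v \<Longrightarrow> {u, v} = {s, t}"
      using fd st unfolding forest_dec_def bridged_def by (elim conjE allE[of _ s] allE[of _ t]) auto
    have memZ: "v \<in> Z \<longleftrightarrow> v \<in> W s \<and> v \<in> W t \<and> ?c s v = Y \<and> ?c t v = Y'" for v
      unfolding Z_def eq by (auto simp: mem)
    have Z: "Z \<subseteq> W s \<inter> W t" using memZ by blast
    have Z': "v \<in> Z" if "u \<in> Z" "v \<in> W s \<inter> W t" "(u, v) \<in> (E\<^sup>=) ^^ m" for u v
      using that near_class_eq[OF sE that(3), of "W s"] near_class_eq[OF sE that(3), of "W t"]
      by (simp add: memZ)
    have "\<exists>f :: 'a \<Rightarrow> bool. \<forall>n. \<forall>a\<in>W n. \<forall>b\<in>W n. (a, b) \<in> (E\<^sup>=) ^^ m \<longrightarrow>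
       f a = f b \<longleftrightarrow> (g n \<and> a \<in> Z \<longleftrightarrow> g n \<and> b \<in> Z)"
      by (rule adhesion_cut_potential[where \<chi> = g and s = s and t = t, OF fd _ Z _ pot sE])
         (fact g(2), fact Z')
    then obtain f :: "'a \<Rightarrow> bool" where f: "\<forall>n. \<forall>a\<in>W n. \<forall>b\<in>W n. (a, b) \<in> (E\<^sup>=) ^^ m \<longrightarrow>
       f a = f b \<longleftrightarrow> (g n \<and> a \<in> Z \<longleftrightarrow> g n \<and> b \<in> Z)" ..
    have const: "(f a \<noteq> (g n \<and> a \<in> Z)) = (f b \<noteq> (g n \<and> b \<in> Z))"
      if "a \<in> ?P (n, U)" "b \<in> ?P (n, U)" for a b n U
    proof (rule rtrancl_invariant[where g = "\<lambda>v. f v \<noteq> (g n \<and> v \<in> Z)"])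
      show "(a, b) \<in> (Restr ((E\<^sup>=) ^^ m) (W n))\<^sup>*"
        using that by (simp add: mem flip: near_class_eq_iff[OF sE])
      fix u v assume "(u, v) \<in> Restr ((E\<^sup>=) ^^ m) (W n)"
      then have "u \<in> W n" "v \<in> W n" "(u, v) \<in> (E\<^sup>=) ^^ m" by blast+
      then have "f u = f v \<longleftrightarrow> (g n \<and> u \<in> Z \<longleftrightarrow> g n \<and> v \<in> Z)" using f by blast
      then show "(f u \<noteq> (g n \<and> u \<in> Z)) = (f v \<noteq> (g n \<and> v \<in> Z))" by blast
    qed
    \<comment> \<open>By \<open>const\<close> any vertex of a component may represent it. Empty
      parts get the colour False and have no incident edge.\<close>
    define h where "h q \<longleftrightarrow> (\<exists>v\<in>?P q. f v \<noteq> (g (fst q) \<and> v \<in> Z))" for q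
    have h: "h (n, U) \<longleftrightarrow> f v \<noteq> (g n \<and> v \<in> Z)" if "v \<in> ?P (n, U)" for n U v
    proof
      assume "h (n, U)"
      then obtain v' where "v' \<in> ?P (n, U)" "f v' \<noteq> (g n \<and> v' \<in> Z)" unfolding h_def by auto
      then show "f v \<noteq> (g n \<and> v \<in> Z)" using const[of v' n U v] that by simp
    next
      assume "f v \<noteq> (g n \<and> v \<in> Z)"
      then show "h (n, U)" unfolding h_def using that by (intro bexI[of _ v]) simp_all
    qed
    show "\<exists>h :: _ \<Rightarrow> bool. h x \<noteq> h y \<and> (\<forall>u v. (u, v) \<in> ?H \<longrightarrow> h u \<noteq> h v \<longrightarrow> {u, v} = {x, y})"
    proof (intro exI[of _ h] conjI allI impI)
      have "z \<in> ?P (s, Y)" "z \<in> ?P (t, Y')" using z eq by (auto simp: Z_def)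
      then show "h x \<noteq> h y" using h[of z s Y] h[of z t Y'] z g(1) unfolding eq by auto
    next
      fix u v assume uv: "(u, v) \<in> ?H" "h u \<noteq> h v"
      obtain a U b U' where ueq: "u = (a, U)" "v = (b, U')" by (metis surj_pair)
      obtain w where w: "w \<in> ?P (a, U)" "w \<in> ?P (b, U')" and ab: "(a, b) \<in> R"
        using uv(1) unfolding refined_rel_def ueq by auto
      \<comment> \<open>The terms \<open>f w\<close> agree, so the colours can differ only through
        \<open>g\<close> and \<open>Z\<close>; and a vertex \<open>w\<close> of \<open>Z\<close>
        determines both components.\<close>
      have "g a \<noteq> g b" "w \<in> Z" using uv(2) h[OF w(1)] h[OF w(2)] unfolding ueq by auto
      then have "{a, b} = {s, t}" using g(2) ab by blast
      moreover have "?c s w = Y" "?c t w = Y'" using \<open>w \<in> Z\<close> unfolding Z_def eq by (auto simp: mem)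
      ultimately show "{u, v} = {x, y}" using w unfolding ueq eq mem by (auto simp: doubleton_eq_iff)
    qed
  qed
  moreover have "conn ?H {n. v \<in> ?P n}" for v
    unfolding conn_def
  proof (intro ballI)
    fix x y assume xy: "x \<in> {n. v \<in> ?P n}" "y \<in> {n. v \<in> ?P n}"
    obtain s Y t Y' where eq: "x = (s, Y)" "y = (t, Y')" by (metis surj_pair)
    have *: "v \<in> W s" "v \<in> W t" "Y = ?c s v" "Y' = ?c t v" using xy unfolding eq by (simp_all add: mem)
    then have "(s, t) \<in> (Restr R {n. v \<in> W n})\<^sup>*" using fd unfolding forest_dec_def conn_def by blast
    then have "((s, ?c s v), (t, ?c t v)) \<in> (Restr ?H {n. v \<in> ?P n})\<^sup>*"
    proof (induction rule: rtrancl_induct)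
      case (step y z)
      then have "v \<in> ?P (y, ?c y v)" "v \<in> ?P (z, ?c z v)" by (auto simp: mem)
      then have "((y, ?c y v), (z, ?c z v)) \<in> Restr ?H {n. v \<in> ?P n}"
        using step.hyps(2) by (auto simp: refined_rel_def)
      then show ?case using step.IH by (rule rtrancl.rtrancl_into_rtrancl[rotated])
    qed simp
    then show "(x, y) \<in> (Restr ?H {n. v \<in> ?P n})\<^sup>*" using * eq by simp
  qed
  moreover have "\<exists>n. v \<in> ?P n" if v: "v \<in> V" for v
  proof -
    obtain t where "v \<in> W t" using fd v unfolding forest_dec_def by blast
    then have "v \<in> ?P (t, ?c t v)" by (simp add: mem)
    then show ?thesis by blast
  qed
  moreover have "\<exists>n. u \<in> ?P n \<and> v \<in> ?P n" if uv: "(u, v) \<in> E" for u v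
  proof -
    obtain t where t: "u \<in> W t" "v \<in> W t" using fd uv unfolding forest_dec_def by blast
    have "(u, v) \<in> (E\<^sup>=) ^^ 1" using uv by simp
    then have "(u, v) \<in> (E\<^sup>=) ^^ m" by (rule relpow_reflcl_mono[OF m])
    then have "?c t u = ?c t v" using near_class_eq[OF sE _ t] by blast
    then have "u \<in> ?P (t, ?c t u)" "v \<in> ?P (t, ?c t u)" using t by (auto simp: mem)
    then show ?thesis by blast
  qed
  ultimately show ?thesis unfolding forest_dec_def by blast
qed

section \<open>Shortest odd closed walks are geodesic cycles\<close>

text \<open>
  In this double cover of the graph, a walk from \<open>(v, False)\<close> to \<open>(v, True)\<close> is a closed walk that
  uses \<open>F\<close> an odd number of times.
\<close>

definition cover_rel :: "'a rel \<Rightarrow> ('a \<Rightarrow> 'a \<Rightarrow> bool) \<Rightarrow> ('a \<times> bool) rel" where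
  "cover_rel E F = {((u, a), (v, b)). (u, v) \<in> E \<and> b = (a \<noteq> F u v)}"

lemma cover_rel_iff [simp]: "((u, a), (v, b)) \<in> cover_rel E F \<longleftrightarrow> (u, v) \<in> E \<and> b = (a \<noteq> F u v)"
  by (simp add: cover_rel_def)

text \<open>Exchanging the two sheets is an automorphism of the double cover.\<close>

lemma cover_relpow_flip:
  "((u, a), (v, b)) \<in> cover_rel E F ^^ n \<Longrightarrow> ((u, \<not> a), (v, \<not> b)) \<in> cover_rel E F ^^ n"
proof (induction n arbitrary: v b)
  case (Suc n)
  then obtain w c where "((u, a), (w, c)) \<in> cover_rel E F ^^ n" "((w, c), (v, b)) \<in> cover_rel E F"
    by (metis relpow_Suc_E surj_pair)
  then show ?case using Suc.IH[of w c] by (intro relpow_Suc_I[of _ "(w, \<not> c)"]) auto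
qed simp

lemma cover_relpow_lift:
  "(u, v) \<in> E ^^ n \<Longrightarrow> \<exists>b. ((u, a), (v, b)) \<in> cover_rel E F ^^ n"
proof (induction n arbitrary: v)
  case (Suc n)
  then obtain w c where "((u, a), (w, c)) \<in> cover_rel E F ^^ n" "(w, v) \<in> E"
    by (metis relpow_Suc_E)
  then show ?case by (intro exI[of _ "c \<noteq> F w v"] relpow_Suc_I[of _ "(w, c)"]) auto
qed simp

lemma sym_cover_rel:
  assumes "sym E" "\<And>u v. F u v = F v u"
  shows "sym (cover_rel E F)"
  using assms by (auto simp: cover_rel_def sym_def)

text \<open>The value \<open>f v\<close> is the sheet on which lifted walks from a root to
  \<open>v\<close> end. Two walks ending on different sheets would combine to an odd closed walk at
  \<open>v\<close>.\<close>

lemma potential_if_no_odd_walk: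
  assumes "sym E" "\<And>u v. F u v = F v u"
    and no: "\<And>v n. ((v, False), (v, True)) \<notin> cover_rel E F ^^ n"
  shows "\<exists>f :: 'a \<Rightarrow> bool. \<forall>u v. (u, v) \<in> E \<longrightarrow> F u v = (f u \<noteq> f v)"
proof -
  let ?D = "(cover_rel E F)\<^sup>*"
  have symD': "sym ?D" by (intro sym_rtrancl sym_cover_rel assms)
  \<comment> \<open>Adjacent vertices are reachable from the same vertices, so this choice gives
    them the same root.\<close>
  define r where "r v = (SOME w. (w, v) \<in> E\<^sup>*)" for v
  have r: "(r v, v) \<in> E\<^sup>*" for v unfolding r_def by (rule someI[of _ v]) simp
  have "r u = r v" if "(u, v) \<in> E" for u v
  proof -
    have "(v, u) \<in> E" using assms(1) that by (rule symD)
    then have "(w, u) \<in> E\<^sup>* \<longleftrightarrow> (w, v) \<in> E\<^sup>*" for w using that by (meson rtrancl.rtrancl_into_rtrancl)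
    then show ?thesis by (simp add: r_def)
  qed
  note r_eq = this
  define f where "f v \<longleftrightarrow> ((r v, False), (v, True)) \<in> ?D" for v
  have f_iff: "f v = b" if "((r v, False), (v, b)) \<in> ?D" for v b
  proof (cases b)
    case False
    show ?thesis
    proof (rule ccontr)
      assume "f v \<noteq> b"
      then have "((r v, False), (v, True)) \<in> ?D" using False by (simp add: f_def)
      moreover have "((v, False), (r v, False)) \<in> ?D" using that False symD' by (auto dest: symD)
      ultimately have "((v, False), (v, True)) \<in> ?D" by (rule rtrancl_trans[rotated])
      then show False using no rtrancl_imp_relpow by blast
    qed
  qed (use that in \<open>simp add: f_def\<close>)
  have ex: "((r v, False), (v, f v)) \<in> ?D" for v
  proof -
    obtain n where "(r v, v) \<in> E ^^ n" using r rtrancl_imp_relpow by blast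
    then obtain b where "((r v, False), (v, b)) \<in> cover_rel E F ^^ n" using cover_relpow_lift[where a = False and F = F] by blast
    then have b: "((r v, False), (v, b)) \<in> ?D" by (rule relpow_imp_rtrancl)
    then show ?thesis using f_iff[OF b] by simp
  qed
  have "f v = (f u \<noteq> F u v)" if "(u, v) \<in> E" for u v
  proof (rule f_iff)
    have "((u, f u), (v, f u \<noteq> F u v)) \<in> cover_rel E F" using that by simp
    then show "((r v, False), (v, f u \<noteq> F u v)) \<in> ?D"
      using ex[of u] r_eq[OF that] by (metis rtrancl.rtrancl_into_rtrancl)
  qed
  then show ?thesis by (intro exI[of _ f]) blast
qed

text \<open>
  A shortest odd closed walk has no shortcuts: a shortcut splits it into two shorter closed walks,
  one of which is again odd.
\<close>

lemma shortest_odd_walk: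
  assumes symE: "sym E" and symF: "\<And>u v. F u v = F v u"
    and no: "\<not> (\<exists>f :: 'a \<Rightarrow> bool. \<forall>u v. (u, v) \<in> E \<longrightarrow> F u v = (f u \<noteq> f v))"
  obtains n w where "w n = w 0" "\<And>i. i < n \<Longrightarrow> (w i, w (Suc i)) \<in> E"
    "\<And>i j q. i \<le> j \<Longrightarrow> j < n \<Longrightarrow> (w i, w j) \<in> E ^^ q \<Longrightarrow> min (j - i) (n - (j - i)) \<le> q"
    "\<not> (\<exists>\<psi> :: 'a \<Rightarrow> bool. \<forall>i<n. F (w i) (w (Suc i)) = (\<psi> (w i) \<noteq> \<psi> (w (Suc i))))"
proof -
  let ?D = "cover_rel E F"
  let ?Q = "\<lambda>n. \<exists>v a. ((v, a), (v, \<not> a)) \<in> ?D ^^ n"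
  have sD: "sym ?D" by (rule sym_cover_rel[OF symE symF])
  obtain v n0 where "((v, False), (v, True)) \<in> ?D ^^ n0"
  proof -
    have "\<exists>v n0. ((v, False), (v, True)) \<in> ?D ^^ n0"
    proof (rule ccontr)
      assume "\<not> ?thesis"
      then have "\<exists>f :: 'a \<Rightarrow> bool. \<forall>u v. (u, v) \<in> E \<longrightarrow> F u v = (f u \<noteq> f v)"
        using symF by (intro potential_if_no_odd_walk[OF symE]) blast+
      with no show False by contradiction
    qed
    then show ?thesis using that by blast
  qed
  then have "?Q n0" by (intro exI[of _ v] exI[of _ False]) simp
  then obtain n where "?Q n" and min: "\<And>j. j < n \<Longrightarrow> \<not> ?Q j"
    using exists_least_iff[of ?Q] by blast
  then obtain v a where "((v, a), (v, \<not> a)) \<in> ?D ^^ n" by blast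
  then obtain h where h: "h 0 = (v, a)" "h n = (v, \<not> a)" "\<And>i. i < n \<Longrightarrow> (h i, h (Suc i)) \<in> ?D"
    unfolding relpow_fun_conv by blast
  define w where "w i = fst (h i)" for i
  define p where "p i = snd (h i)" for i
  have hi: "h i = (w i, p i)" for i by (simp add: w_def p_def)
  have ends: "w n = w 0" "p n \<noteq> p 0" using h(1,2) by (simp_all add: w_def p_def)
  have step: "(w i, w (Suc i)) \<in> E" "p (Suc i) = (p i \<noteq> F (w i) (w (Suc i)))" if "i < n" for i
    using h(3)[OF that] by (simp_all add: hi)
  have seg: "((w i, p i), (w j, p j)) \<in> ?D ^^ (j - i)" if "i \<le> j" "j \<le> n" for i j
    using relpow_segment[where f = h and n = n and R = ?D, OF _ that] h(3) by (simp add: hi)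
  show ?thesis
  proof
    show "w n = w 0" by (rule ends)
    show "(w i, w (Suc i)) \<in> E" if "i < n" for i using that by (rule step)
  next
    fix i j q assume ij: "i \<le> j" "j < n" and q: "(w i, w j) \<in> E ^^ q"
    obtain c where c: "((w i, p i), (w j, c)) \<in> ?D ^^ q" using cover_relpow_lift[OF q, where a = "p i" and F = F] by blast
    \<comment> \<open>The lifted shortcut ends on some sheet \<open>c\<close>. If this is the sheet
      of the walk, the shortcut can replace the segment from \<open>i\<close> to \<open>j\<close>;
      otherwise it forms an odd closed walk with the reversed segment.\<close>
    have "?Q (q + (j - i)) \<or> ?Q (i + q + (n - j))"
    proof (cases "c = p j")
      case True
      have "((w 0, p 0), (w i, p i)) \<in> ?D ^^ i" using seg[of 0 i] ij by simp
      moreover have "((w j, p j), (w 0, \<not> p 0)) \<in> ?D ^^ (n - j)" using seg[of j n] ij ends by simp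
      ultimately have "((w 0, p 0), (w 0, \<not> p 0)) \<in> ?D ^^ (i + q + (n - j))"
        using c True by (blast intro: relpow_trans_add)
      then show ?thesis by blast
    next
      case False
      have "((w j, p j), (w i, p i)) \<in> ?D ^^ (j - i)"
        using seg[of i j] ij sym_relpow[OF sD] by (auto dest: symD)
      then have "((w j, \<not> p j), (w i, \<not> p i)) \<in> ?D ^^ (j - i)" by (rule cover_relpow_flip)
      then have "((w i, p i), (w i, \<not> p i)) \<in> ?D ^^ (q + (j - i))"
        using c False by (intro relpow_trans_add[of _ "(w j, c)"]) auto
      then show ?thesis by blast
    qed
    then have "n \<le> q + (j - i) \<or> n \<le> i + q + (n - j)" using min by (meson not_le)
    then show "Orderings.min (j - i) (n - (j - i)) \<le> q" using ij by linarith
  next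
    show "\<not> (\<exists>\<psi> :: 'a \<Rightarrow> bool. \<forall>i<n. F (w i) (w (Suc i)) = (\<psi> (w i) \<noteq> \<psi> (w (Suc i))))"
    proof
      assume "\<exists>\<psi> :: 'a \<Rightarrow> bool. \<forall>i<n. F (w i) (w (Suc i)) = (\<psi> (w i) \<noteq> \<psi> (w (Suc i)))"
      then obtain \<psi> :: "'a \<Rightarrow> bool" where \<psi>: "\<And>i. i < n \<Longrightarrow> F (w i) (w (Suc i)) = (\<psi> (w i) \<noteq> \<psi> (w (Suc i)))"
        by blast
      \<comment> \<open>With such a \<psi>, the sheet and the value of \<psi> would change at the
        same steps, so the closed walk would end on its first sheet.\<close>
      have "(p i \<noteq> \<psi> (w i)) = (p 0 \<noteq> \<psi> (w 0))" if "i \<le> n" for i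
        using that
      proof (induction i)
        case (Suc i)
        then show ?case using step(2)[of i] \<psi>[of i] by auto
      qed simp
      from this[of n] show False using ends by auto
    qed
  qed
qed

text \<open>The lack of shortcuts makes the vertices of a shortest odd closed walk distinct, and the
  shorter arcs between them are shortest paths of \<open>G\<close>. The last two conclusions let
  \<open>vertices C\<close> refute the local hypothesis on \<open>F\<close> in
  \<open>locally_exact\<close>.\<close>

lemma odd_geodesic_cycle:
  assumes G: "simple_graph G" and symF: "\<And>u v. F u v = F v u"
    and no: "\<not> (\<exists>f :: 'a \<Rightarrow> bool. \<forall>u v. (u, v) \<in> adj G \<longrightarrow> F u v = (f u \<noteq> f v))"
  obtains C where "geodesic_cycle C G" "cycle_length C \<ge> 3"
    "\<And>u v. u \<in> vertices C \<Longrightarrow> v \<in> vertices C \<Longrightarrow> (u, v) \<in> ((adj G)\<^sup>=) ^^ (cycle_length C div 2)"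
    "\<not> (\<exists>\<psi> :: 'a \<Rightarrow> bool. \<forall>u\<in>vertices C. \<forall>v\<in>vertices C. (u, v) \<in> adj G \<longrightarrow> F u v = (\<psi> u \<noteq> \<psi> v))"
proof -
  obtain n w where closed: "w n = w 0" and step: "\<And>i. i < n \<Longrightarrow> (w i, w (Suc i)) \<in> adj G"
    and short: "\<And>i j q. i \<le> j \<Longrightarrow> j < n \<Longrightarrow> (w i, w j) \<in> adj G ^^ q \<Longrightarrow> min (j - i) (n - (j - i)) \<le> q"
    and odd: "\<not> (\<exists>\<psi> :: 'a \<Rightarrow> bool. \<forall>i<n. F (w i) (w (Suc i)) = (\<psi> (w i) \<noteq> \<psi> (w (Suc i))))"
    using shortest_odd_walk[OF sym_adj symF no] by metis
  have "n > 0" using odd by auto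
  have neq: "w i \<noteq> w (Suc i)" if "i < n" for i using adj_vertices[OF G step[OF that]] by simp
  have "n \<noteq> 1" using neq[of 0] closed by auto
  \<comment> \<open>A closed walk of length 2 runs along one edge and back, and a \<psi> supported
    at \<open>w 0\<close> then matches \<open>F\<close>.\<close>
  moreover have "n \<noteq> 2"
  proof
    assume "n = 2"
    define \<psi> where "\<psi> v \<longleftrightarrow> v = w 0 \<and> F (w 0) (w 1)" for v
    have "F (w i) (w (Suc i)) = (\<psi> (w i) \<noteq> \<psi> (w (Suc i)))" if "i < n" for i
    proof -
      have "i = 0 \<or> i = 1" "w (Suc 1) = w 0" "w 1 \<noteq> w 0"
        using that \<open>n = 2\<close> closed neq[of 0] by (auto simp: numeral_2_eq_2)
      then show ?thesis using symF[of "w 1" "w 0"] by (auto simp: \<psi>_def)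
    qed
    then show False using odd by blast
  qed
  ultimately have n3: "n \<ge> 3" using \<open>n > 0\<close> by linarith
  \<comment> \<open>This is the case \<open>q = 0\<close>: a repeated vertex would be a shortcut of
    length 0.\<close>
  have dist_w: "w i \<noteq> w j" if "i < j" "j < n" for i j
    using short[of i j 0] that by auto
  have inj: "inj_on w {..<n}"
    by (rule linorder_inj_onI') (use dist_w in auto)
  define C where "C = \<lparr>vertices = w ` {..<n}, edges = (\<lambda>i. {w i, w (Suc i)}) ` {..<n}\<rparr>"
  have wV: "w i \<in> vertices C" if "i \<le> n" for i
    using that closed \<open>n > 0\<close> by (cases "i = n") (auto simp: C_def)
  have cyc: "is_cycle C"
    unfolding is_cycle_def
  proof (intro exI[of _ "map w [0..<n]"] conjI)
    have nth: "map w [0..<n] ! (Suc i mod n) = w (Suc i)" if "i < n" for i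
      using that closed \<open>n > 0\<close> by (cases "Suc i = n") auto
    show "edges C = {{map w [0..<n] ! i, map w [0..<n] ! (Suc i mod length (map w [0..<n]))} |i.
        i < length (map w [0..<n])}" (is "_ = ?E")
    proof -
      have "edges C = {{w i, w (Suc i)} |i. i < n}" by (auto simp: C_def)
      also have "\<dots> = ?E" by (rule Collect_cong, rule iff_exI) (use nth in auto)
      finally show ?thesis .
    qed
  qed (use n3 inj in \<open>auto simp: C_def distinct_map atLeast0LessThan\<close>)
  have "inj_on (\<lambda>i. {w i, w (Suc i)}) {..<n}"
  proof (rule linorder_inj_onI')
    fix i j assume ij: "i \<in> {..<n}" "j \<in> {..<n}" "i < j"
    show "{w i, w (Suc i)} \<noteq> {w j, w (Suc j)}"
    proof
      assume "{w i, w (Suc i)} = {w j, w (Suc j)}"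
      then have eq: "w i = w (Suc j)" "w (Suc i) = w j" using dist_w[of i j] ij by (auto simp: doubleton_eq_iff)
      have "Suc i = j" using dist_w[of "Suc i" j] ij eq(2) by (metis lessThan_iff less_Suc_eq not_less_eq)
      moreover have "Suc j = n" using dist_w[of i "Suc j"] ij eq(1) by (metis lessThan_iff less_SucI not_less_eq less_antisym)
      moreover from this have "i = 0" using dist_w[of 0 i] ij eq(1) closed by auto
      ultimately show False using n3 by simp
    qed
  qed
  then have len: "cycle_length C = n" by (simp add: cycle_length_def C_def card_image)
  have sub: "subgraph C G"
  proof -
    have "(w i, w (Suc i)) \<in> adj G \<and> w i \<in> vertices G \<and> w i \<noteq> w (Suc i) \<and> w i \<in> vertices C \<and> w (Suc i) \<in> vertices C"
      if "i < n" for i using step[OF that] adj_vertices[OF G step[OF that]] wV[of i] wV[of "Suc i"] that by simp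
    then show ?thesis
      unfolding subgraph_def simple_graph_def by (fastforce simp: C_def adj_def)
  qed
  have stepC: "(w i, w (Suc i)) \<in> adj C" if "i < n" for i
    using that by (auto simp: C_def adj_def)
  have arcs: "(w i, w j) \<in> adj C ^^ min (j - i) (n - (j - i))" if "i \<le> j" "j < n" for i j
  proof -
    have seg: "(w a, w b) \<in> adj C ^^ (b - a)" if "a \<le> b" "b \<le> n" for a b
      using relpow_segment[where f = w and n = n and R = "adj C", OF _ that] stepC by blast
    have "(w j, w 0) \<in> adj C ^^ (n - j)" using seg[of j n] that closed by simp
    then have "(w j, w i) \<in> adj C ^^ (n - j + i)"
      using seg[of 0 i] that by (intro relpow_trans_add[of _ "w 0"]) auto
    then have "(w i, w j) \<in> adj C ^^ (n - (j - i))"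
      using adj_relpow_sym that by (metis Nat.diff_diff_right order.strict_implies_order Nat.add_diff_assoc2)
    then show ?thesis using seg[of i j] that by (simp add: min_def)
  qed
  have CG: "adj C \<subseteq> adj G" using sub by (auto simp: subgraph_def adj_def)
  have Csimple: "simple_graph C" using sub by (simp add: subgraph_def)
  have geo: "\<exists>q. (x, y) \<in> adj C ^^ q \<and> q \<le> n div 2 \<and> (\<forall>q'. (x, y) \<in> adj G ^^ q' \<longrightarrow> q \<le> q')"
    if xy: "x \<in> vertices C" "y \<in> vertices C" for x y
  proof -
    obtain i j where ij: "x = w i" "y = w j" "i < n" "j < n" using xy by (auto simp: C_def)
    have half: "min d (n - d) \<le> n div 2" for d by linarith
    show ?thesis
    proof (cases "i \<le> j")
      case True
      then show ?thesis using arcs[of i j] short[of i j] ij half by blast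
    next
      case False
      then have "(w i, w j) \<in> adj C ^^ min (i - j) (n - (i - j))"
        using arcs[of j i] ij adj_relpow_sym by (metis nat_le_linear)
      moreover have "min (i - j) (n - (i - j)) \<le> q'" if "(w i, w j) \<in> adj G ^^ q'" for q'
      proof (rule short)
        show "(w j, w i) \<in> adj G ^^ q'" using that by (rule adj_relpow_sym)
      qed (use False ij in auto)
      ultimately show ?thesis using ij half by blast
    qed
  qed
  have relpow_CG: "(x, y) \<in> adj C ^^ q \<Longrightarrow> (x, y) \<in> adj G ^^ q" for x y q
    using CG by (auto simp: relpow_fun_conv)
  have "graph_dist C x y = graph_dist G x y" if xy: "x \<in> vertices C" "y \<in> vertices C" for x y
  proof -
    obtain q where q: "(x, y) \<in> adj C ^^ q" "\<And>q'. (x, y) \<in> adj G ^^ q' \<Longrightarrow> q \<le> q'" using geo[OF xy] by blast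
    have "x \<in> vertices G" using sub xy(1) by (auto simp: subgraph_def)
    then have "graph_dist C x y = enat q" "graph_dist G x y = enat q"
      using graph_dist_le[OF Csimple xy(1) relpow_imp_reflcl[OF q(1)]]
        graph_dist_le[OF G _ relpow_imp_reflcl[OF relpow_CG[OF q(1)]]]
        graph_dist_ge[of x y G q, OF q(2)] graph_dist_ge[of x y C q, OF q(2)[OF relpow_CG]]
      by (auto intro: antisym)
    then show ?thesis by simp
  qed
  then have "geodesic_cycle C G" unfolding geodesic_cycle_def geodesic_subgraph_def using cyc sub by blast
  moreover have "cycle_length C \<ge> 3" using len n3 by simp
  moreover have "(x, y) \<in> ((adj G)\<^sup>=) ^^ (cycle_length C div 2)" if xy: "x \<in> vertices C" "y \<in> vertices C" for x y
  proof -
    obtain q where "(x, y) \<in> adj C ^^ q" "q \<le> n div 2" using geo[OF xy] by blast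
    then show ?thesis unfolding len
      using relpow_reflcl_mono[OF _ relpow_imp_reflcl[OF relpow_CG]] by blast
  qed
  moreover have "\<not> (\<exists>\<psi> :: 'a \<Rightarrow> bool. \<forall>u\<in>vertices C. \<forall>v\<in>vertices C. (u, v) \<in> adj G \<longrightarrow> F u v = (\<psi> u \<noteq> \<psi> v))"
  proof
    assume "\<exists>\<psi> :: 'a \<Rightarrow> bool. \<forall>u\<in>vertices C. \<forall>v\<in>vertices C. (u, v) \<in> adj G \<longrightarrow> F u v = (\<psi> u \<noteq> \<psi> v)"
    then obtain \<psi> :: "'a \<Rightarrow> bool" where
      "\<forall>u\<in>vertices C. \<forall>v\<in>vertices C. (u, v) \<in> adj G \<longrightarrow> F u v = (\<psi> u \<noteq> \<psi> v)" ..
    then have "\<forall>i<n. F (w i) (w (Suc i)) = (\<psi> (w i) \<noteq> \<psi> (w (Suc i)))"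
      using step wV by simp
    with odd show False by blast
  qed
  ultimately show ?thesis by (rule that)
qed

text \<open>If \<open>F\<close> had no potential, it would have none on the vertices of some
  geodesic cycle; but these are within \<open>l div 2\<close> of each other, where \<open>F\<close>
  is assumed to have one.\<close>

lemma locally_exact_adj:
  assumes "simple_graph G" "\<And>C. geodesic_cycle C G \<Longrightarrow> cycle_length C \<le> l"
  shows "locally_exact (adj G) (l div 2)"
  unfolding locally_exact_def
proof (intro allI impI)
  fix F :: "'a \<Rightarrow> 'a \<Rightarrow> bool"
  assume F: "\<forall>u v. F u v = F v u"
    and loc: "\<forall>S. (\<forall>u\<in>S. \<forall>v\<in>S. (u, v) \<in> ((adj G)\<^sup>=) ^^ (l div 2)) \<longrightarrow>
       (\<exists>\<psi> :: 'a \<Rightarrow> bool. \<forall>u\<in>S. \<forall>v\<in>S. (u, v) \<in> adj G \<longrightarrow> F u v = (\<psi> u \<noteq> \<psi> v))"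
  show "\<exists>f :: 'a \<Rightarrow> bool. \<forall>u v. (u, v) \<in> adj G \<longrightarrow> F u v = (f u \<noteq> f v)"
  proof (rule ccontr)
    assume no: "\<not> (\<exists>f :: 'a \<Rightarrow> bool. \<forall>u v. (u, v) \<in> adj G \<longrightarrow> F u v = (f u \<noteq> f v))"
    have F': "F u v = F v u" for u v using F by blast
    obtain C where C: "geodesic_cycle C G"
        "\<And>u v. u \<in> vertices C \<Longrightarrow> v \<in> vertices C \<Longrightarrow> (u, v) \<in> ((adj G)\<^sup>=) ^^ (cycle_length C div 2)"
        "\<not> (\<exists>\<psi> :: 'a \<Rightarrow> bool. \<forall>u\<in>vertices C. \<forall>v\<in>vertices C. (u, v) \<in> adj G \<longrightarrow> F u v = (\<psi> u \<noteq> \<psi> v))"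
      using odd_geodesic_cycle[OF assms(1) F' no] by metis
    have "cycle_length C div 2 \<le> l div 2" using assms(2)[OF C(1)] by (rule div_le_mono)
    then have "\<forall>u\<in>vertices C. \<forall>v\<in>vertices C. (u, v) \<in> ((adj G)\<^sup>=) ^^ (l div 2)"
      using C(2) by (blast intro: relpow_reflcl_mono)
    then show False using loc C(3) by blast
  qed
qed

section \<open>Hyperbolicity\<close>

lemma conn_set:
  assumes "sym E" "successively (\<lambda>u v. (u, v) \<in> E) p"
  shows "conn E (set p)"
proof -
  let ?R = "Restr E (set p)"
  have le: "(p ! i, p ! j) \<in> ?R\<^sup>*" if "i \<le> j" "j < length p" for i j
  proof -
    have "(p ! i, p ! j) \<in> ?R ^^ (j - i)"
      by (rule relpow_segment[where n = "length p - 1"]) (use that assms(2) in \<open>auto simp: successively_conv_nth\<close>)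
    then show ?thesis by (rule relpow_imp_rtrancl)
  qed
  have "sym (?R\<^sup>*)" using assms(1) by (intro sym_rtrancl sym_Restr)
  then have "(p ! i, p ! j) \<in> ?R\<^sup>*" if "i < length p" "j < length p" for i j
    using le[of i j] le[of j i] that by (meson nat_le_linear symD)
  then show ?thesis unfolding conn_def by (metis in_set_conv_nth)
qed

lemma conn_Un:
  assumes "conn E A" "conn E B" "c \<in> A" "c \<in> B"
  shows "conn E (A \<union> B)"
proof -
  have mono: "(x, y) \<in> (Restr E (A \<union> B))\<^sup>*" if "(x, y) \<in> (Restr E S)\<^sup>*" "S \<subseteq> A \<union> B" for x y S
    using that(1) by (rule rtrancl_mono[THEN subsetD, rotated]) (use that(2) in blast)
  have "(x, c) \<in> (Restr E (A \<union> B))\<^sup>* \<and> (c, x) \<in> (Restr E (A \<union> B))\<^sup>*" if "x \<in> A \<union> B" for x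
    using that assms mono[of _ _ A] mono[of _ _ B] unfolding conn_def by blast
  then show ?thesis unfolding conn_def by (blast intro: rtrancl_trans)
qed

text \<open>A component has at most \<open>k\<close> vertices, so two of them are joined by at most
  \<open>k - 1\<close> steps of nearness, each of length at most \<open>m\<close>.\<close>

lemma refined_part_diameter:
  assumes "sym E" "finite (W t)" "card (W t) \<le> k"
    and uv: "u \<in> refined_part E m W (t, Y)" "v \<in> refined_part E m W (t, Y)"
  shows "(u, v) \<in> (E\<^sup>=) ^^ (m * (k - 1))"
proof -
  let ?N = "(E\<^sup>=) ^^ m"
  have "(u, v) \<in> (Restr ?N (W t))\<^sup>*" and u: "u \<in> W t"
    using uv by (auto simp: refined_part_def simp flip: near_class_eq_iff[OF assms(1)])
  then obtain p where p: "p \<noteq> []" "hd p = u" "last p = v" "distinct p"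
      "successively (\<lambda>x y. (x, y) \<in> Restr ?N (W t)) p"
    using rtrancl_imp_distinct by metis
  have "set p \<subseteq> W t" using p(1,2,5) u
  proof (induction p arbitrary: u)
    case (Cons a p)
    then show ?case by (cases p) auto
  qed simp
  then have len: "length p \<le> k"
    using p(4) assms(2,3) by (metis card_mono distinct_card le_trans)
  have "(u, v) \<in> Restr ?N (W t) ^^ (length p - 1)"
    using successively_imp_relpow[OF p(5,1)] p(2,3) by simp
  then have "(u, v) \<in> ?N ^^ (length p - 1)" by (auto simp: relpow_fun_conv)
  then have "(u, v) \<in> (E\<^sup>=) ^^ (m * (length p - 1))" by (simp add: relpow_relpow)
  moreover have "m * (length p - 1) \<le> m * (k - 1)" using len by (intro mult_le_mono) auto
  ultimately show ?thesis by (rule relpow_reflcl_mono[rotated])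
qed

text \<open>\<open>C\<close> stands for the union of the other two sides. The path is cut at
  \<open>u\<close>, and the Helly property is applied to its two pieces and \<open>C\<close>, which
  meet pairwise in \<open>u\<close>, \<open>x\<close> and \<open>y\<close>. The bound
  \<open>3 / 2 * D\<close> is written without division.\<close>

lemma shortest_path_near_connected:
  assumes G: "simple_graph G" and fd: "forest_dec (vertices G) (adj G) R P"
    and diam: "\<And>n u v. u \<in> P n \<Longrightarrow> v \<in> P n \<Longrightarrow> (u, v) \<in> ((adj G)\<^sup>=) ^^ D"
    and p: "shortest_path G x p y" and C: "conn (adj G) C" "x \<in> C" "y \<in> C" and u: "u \<in> set p"
  shows "\<exists>c\<in>C. \<exists>d. 2 * d \<le> 3 * D \<and> (u, c) \<in> ((adj G)\<^sup>=) ^^ d"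
proof -
  let ?E = "(adj G)\<^sup>="
  have pb: "p \<noteq> []" "hd p = x" "last p = y" "set p \<subseteq> vertices G" "successively (\<lambda>u v. (u, v) \<in> adj G) p"
    using p by (auto simp: shortest_path_def path_between_iff_adj)
  have dist: "graph_dist G x y = enat (length p - 1)" using p by (simp add: shortest_path_def path_length_def)
  obtain j where j: "j < length p" "u = p ! j" using u by (metis in_set_conv_nth)
  let ?A = "set (take (Suc j) p)" and ?B = "set (drop j p)"
  have succ: "successively (\<lambda>u v. (u, v) \<in> adj G) (take (Suc j) p)" "successively (\<lambda>u v. (u, v) \<in> adj G) (drop j p)"
    using pb(5) by (auto simp: successively_conv_nth)
  have memA: "v \<in> ?A \<longleftrightarrow> (\<exists>i\<le>j. v = p ! i)" for v
    using j(1) by (auto simp: in_set_conv_nth less_Suc_eq_le)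
  have memB: "v \<in> ?B \<longleftrightarrow> (\<exists>i\<ge>j. i < length p \<and> v = p ! i)" for v
  proof
    assume "v \<in> ?B"
    then obtain i where "i < length p - j" "v = p ! (j + i)" using j(1) by (auto simp: in_set_conv_nth)
    then show "\<exists>i\<ge>j. i < length p \<and> v = p ! i" by (intro exI[of _ "j + i"]) auto
  next
    assume "\<exists>i\<ge>j. i < length p \<and> v = p ! i"
    then obtain i where "j \<le> i" "i < length p" "v = p ! i" by blast
    then show "v \<in> ?B" by (auto simp: in_set_conv_nth intro!: exI[of _ "i - j"])
  qed
  have AB: "u \<in> ?A" "u \<in> ?B" "x \<in> ?A" "y \<in> ?B"
  proof -
    show "u \<in> ?A" "u \<in> ?B" using j by (auto simp: memA memB)
    show "x \<in> ?A" using pb(1,2) by (auto simp: memA hd_conv_nth)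
    have "y = p ! (length p - 1)" "j \<le> length p - 1" "length p - 1 < length p"
      using pb(1,3) j(1) by (auto simp: last_conv_nth)
    then show "y \<in> ?B" unfolding memB by blast
  qed
  have node: "\<exists>n. P n \<inter> S \<noteq> {} \<and> P n \<inter> S' \<noteq> {}" if "v \<in> S" "v \<in> S'" "v \<in> set p" for v S S'
  proof -
    obtain n where "v \<in> P n" using fd \<open>v \<in> set p\<close> pb(4) unfolding forest_dec_def by blast
    then show ?thesis using \<open>v \<in> S\<close> \<open>v \<in> S'\<close> by blast
  qed
  have "x \<in> set p" "y \<in> set p" using pb(1-3) by auto
  then obtain n where "P n \<inter> ?A \<noteq> {}" "P n \<inter> ?B \<noteq> {}" "P n \<inter> C \<noteq> {}"
    using forest_dec_Helly[OF fd conn_set[OF sym_adj succ(1)] conn_set[OF sym_adj succ(2)] C(1)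
        node[OF AB(1,2) u] node[OF AB(4) C(3)] node[OF AB(3) C(2)]] by blast
  then obtain i l c where ic: "p ! i \<in> P n" "i \<le> j" "p ! l \<in> P n" "j \<le> l" "l < length p" "c \<in> P n" "c \<in> C"
    unfolding disjoint_iff memA memB by blast
  have seg: "(p ! a, p ! b) \<in> ?E ^^ (b - a)" if "a \<le> b" "b < length p" for a b
    by (rule relpow_segment[where n = "length p - 1"]) (use that pb(5) in \<open>auto simp: successively_conv_nth\<close>)
  \<comment> \<open>A detour through the part replaces the segment from \<open>i\<close> to
    \<open>l\<close>; since \<open>p\<close> is shortest, this gives
    \<open>l - i \<le> D\<close>.\<close>
  have "(p ! 0, p ! (length p - 1)) \<in> ?E ^^ (i + D + (length p - 1 - l))"
  proof (intro relpow_trans_add)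
    show "(p ! 0, p ! i) \<in> ?E ^^ i" using seg[of 0 i] ic by simp
    show "(p ! i, p ! l) \<in> ?E ^^ D" using diam ic by blast
    show "(p ! l, p ! (length p - 1)) \<in> ?E ^^ (length p - 1 - l)" using seg[of l "length p - 1"] ic by simp
  qed
  then have "(x, y) \<in> ?E ^^ (i + D + (length p - 1 - l))" using pb(1-3) by (simp add: hd_conv_nth last_conv_nth)
  then have "graph_dist G x y \<le> enat (i + D + (length p - 1 - l))"
    using graph_dist_le[OF G] \<open>x \<in> set p\<close> pb(4) by blast
  then have "l - i \<le> D" using dist ic by simp
  then have "2 * (j - i) \<le> D \<or> 2 * (l - j) \<le> D" by linarith
  then show ?thesis
  proof
    assume le: "2 * (j - i) \<le> D"
    have "sym ?E" using sym_adj[of G] by (auto simp: sym_def)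
    then have "(u, p ! i) \<in> ?E ^^ (j - i)" using seg[of i j] j ic(2) sym_relpow by (metis symD)
    moreover have "(p ! i, c) \<in> ?E ^^ D" using diam ic by blast
    ultimately have "(u, c) \<in> ?E ^^ (j - i + D)" by (rule relpow_trans_add)
    then show ?thesis using le ic(7) by (intro bexI[of _ c] exI[of _ "j - i + D"]) auto
  next
    assume le: "2 * (l - j) \<le> D"
    have "(u, p ! l) \<in> ?E ^^ (l - j)" using seg[of j l] j ic by simp
    moreover have "(p ! l, c) \<in> ?E ^^ D" using diam ic by blast
    ultimately have "(u, c) \<in> ?E ^^ (l - j + D)" by (rule relpow_trans_add)
    then show ?thesis using le ic(7) by (intro bexI[of _ c] exI[of _ "l - j + D"]) auto
  qed
qed

text \<open>Finite distances are natural numbers, so \<delta> only has to bound the naturals up to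
  \<open>3 / 2 * D\<close>; this admits the floor in the theorem.\<close>

lemma hyperbolic_if_forest_dec:
  assumes G: "simple_graph G" and fd: "forest_dec (vertices G) (adj G) R P"
    and diam: "\<And>n u v. u \<in> P n \<Longrightarrow> v \<in> P n \<Longrightarrow> (u, v) \<in> ((adj G)\<^sup>=) ^^ D"
    and \<delta>: "\<And>d :: nat. 2 * d \<le> 3 * D \<Longrightarrow> real d \<le> \<delta>"
  shows "hyperbolic \<delta> G"
proof -
  have within: "within_dist G \<delta> (set p) C"
    if p: "shortest_path G x p y" and C: "conn (adj G) C" "x \<in> C" "y \<in> C" for x p y C
    unfolding within_dist_def
  proof
    fix u assume u: "u \<in> set p"
    have "\<exists>c\<in>C. \<exists>d. 2 * d \<le> 3 * D \<and> (u, c) \<in> ((adj G)\<^sup>=) ^^ d"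
      by (rule shortest_path_near_connected[OF G fd _ p C u]) (rule diam)
    then obtain c d where c: "c \<in> C" "2 * d \<le> 3 * D" "(u, c) \<in> ((adj G)\<^sup>=) ^^ d" by blast
    have "u \<in> vertices G" using u p by (auto simp: shortest_path_def path_between_def)
    then have "graph_dist G u c \<le> enat d" using c(3) by (rule graph_dist_le[OF G])
    then have "ereal_of_enat (graph_dist G u c) \<le> ereal_of_enat (enat d)" by (simp only: ereal_of_enat_le_iff)
    also have "\<dots> \<le> ereal \<delta>" using \<delta>[OF c(2)] by simp
    finally show "\<exists>c\<in>C. ereal_of_enat (graph_dist G u c) \<le> ereal \<delta>" using c(1) by blast
  qed
  have path: "conn (adj G) (set p) \<and> x \<in> set p \<and> y \<in> set p" if "shortest_path G x p y" for x p y
    using that conn_set[OF sym_adj, of G p] by (auto simp: shortest_path_def path_between_iff_adj)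
  have "0 \<le> \<delta>" using \<delta>[of 0] by simp
  moreover have "within_dist G \<delta> (set P) (set Q \<union> set R) \<and> within_dist G \<delta> (set Q) (set P \<union> set R) \<and>
      within_dist G \<delta> (set R) (set P \<union> set Q)"
    if "shortest_path G x P y" "shortest_path G y Q z" "shortest_path G x R z" for x y z P Q R
    using within[OF that(1), of "set Q \<union> set R"] within[OF that(2), of "set P \<union> set R"]
      within[OF that(3), of "set P \<union> set Q"] path[OF that(1)] path[OF that(2)] path[OF that(3)]
      conn_Un[of "adj G" "set Q" "set R" z] conn_Un[of "adj G" "set P" "set R" x]
      conn_Un[of "adj G" "set P" "set Q" y] by blast
  ultimately show ?thesis unfolding hyperbolic_def by blast
qed

section \<open>Consequences of the existence of a cycle\<close>

lemma not_forest_cycle: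
  assumes "simple_graph G" "\<not> forest G"
  obtains xs where "distinct xs" "length xs \<ge> 3"
    "\<And>i. i < length xs \<Longrightarrow> (xs ! i, xs ! (Suc i mod length xs)) \<in> adj G"
proof -
  obtain C where C: "is_cycle C" "subgraph C G" using assms unfolding forest_def by blast
  from C(1) obtain xs where xs: "distinct xs \<and> length xs \<ge> 3 \<and> vertices C = set xs \<and>
      edges C = {{xs ! i, xs ! (Suc i mod length xs)} | i. i < length xs}"
    unfolding is_cycle_def ..
  have "edges C \<subseteq> edges G" using C(2) by (simp add: subgraph_def)
  then have "(xs ! i, xs ! (Suc i mod length xs)) \<in> adj G" if "i < length xs" for i
    using xs that unfolding adj_def by blast
  then show ?thesis using xs by (intro that[of xs]) simp_all
qed

text \<open>An odd closed walk is obtained by letting \<open>F\<close> hold on a single edge of the given cycle.\<close>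

lemma geodesic_cycle_exists:
  assumes G: "simple_graph G" and xs: "distinct xs" "length xs \<ge> 3"
    "\<And>i. i < length xs \<Longrightarrow> (xs ! i, xs ! (Suc i mod length xs)) \<in> adj G"
  obtains C where "geodesic_cycle C G" "cycle_length C \<ge> 3"
proof -
  let ?n = "length xs"
  define F where "F u v \<longleftrightarrow> {u, v} = {xs ! 0, xs ! (?n - 1)}" for u v
  have "\<not> (\<exists>f :: 'a \<Rightarrow> bool. \<forall>u v. (u, v) \<in> adj G \<longrightarrow> F u v = (f u \<noteq> f v))"
  proof
    assume "\<exists>f :: 'a \<Rightarrow> bool. \<forall>u v. (u, v) \<in> adj G \<longrightarrow> F u v = (f u \<noteq> f v)"
    then obtain f :: "'a \<Rightarrow> bool" where f: "\<And>u v. (u, v) \<in> adj G \<Longrightarrow> F u v = (f u \<noteq> f v)" by blast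
    \<comment> \<open>\<open>F\<close> fails on all edges of the cycle but the closing one, so
      \<open>f\<close> is constant along the list, while the closing edge demands different values
      at its ends.\<close>
    have "f (xs ! i) = f (xs ! 0)" if "i < ?n" for i
      using that
    proof (induction i)
      case (Suc i)
      have "\<not> F (xs ! i) (xs ! Suc i)"
      proof
        assume "F (xs ! i) (xs ! Suc i)"
        then have "xs ! i = xs ! 0 \<and> xs ! Suc i = xs ! (?n - 1) \<or> xs ! i = xs ! (?n - 1) \<and> xs ! Suc i = xs ! 0"
          by (auto simp: F_def doubleton_eq_iff)
        moreover have "i < ?n" "0 < ?n" "?n - 1 < ?n" using Suc.prems by auto
        ultimately have "i = 0 \<and> Suc i = ?n - 1 \<or> i = ?n - 1 \<and> Suc i = 0"
          using Suc.prems nth_eq_iff_index_eq[OF xs(1)] by metis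
        then show False using xs(2) by auto
      qed
      moreover have "(xs ! i, xs ! Suc i) \<in> adj G" using xs(3)[of i] Suc.prems by simp
      ultimately show ?case using f Suc by auto
    qed simp
    moreover have "Suc (?n - 1) = ?n" "?n - 1 < ?n" using xs(2) by auto
    then have "(xs ! (?n - 1), xs ! 0) \<in> adj G" using xs(3)[of "?n - 1"] by simp
    then have "f (xs ! (?n - 1)) \<noteq> f (xs ! 0)" using f[of "xs ! (?n - 1)" "xs ! 0"] by (auto simp: F_def)
    ultimately show False using xs(2) by auto
  qed
  note no_potential = this
  have symF: "F u v = F v u" for u v by (simp add: F_def insert_commute)
  show ?thesis by (rule odd_geodesic_cycle[OF G symF no_potential]) (rule that)
qed

text \<open>The Helly property for two consecutive vertices of the cycle and the path of the
  remaining ones yields a part that contains three distinct vertices. In the theorem this gives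
  \<open>k \<ge> 3\<close>.\<close>

lemma forest_dec_cycle_part:
  assumes fd: "forest_dec V E R W" and "sym E" and xs: "distinct xs" "length xs \<ge> 3"
    "\<And>i. i < length xs \<Longrightarrow> (xs ! i, xs ! (Suc i mod length xs)) \<in> E" and fin: "\<And>n. finite (W n)"
  obtains n where "card (W n) \<ge> 3"
proof -
  obtain a b c ys where eq: "xs = a # b # c # ys"
    using xs(2) by (metis One_nat_def Suc_le_length_iff numeral_3_eq_3)
  have succ: "successively (\<lambda>u v. (u, v) \<in> E) (c # ys)"
    unfolding successively_conv_nth
  proof (intro allI impI)
    fix i assume "Suc i < length (c # ys)"
    then show "((c # ys) ! i, (c # ys) ! Suc i) \<in> E" using xs(3)[of "i + 2"] eq by simp
  qed
  have single: "conn E {v}" for v by (auto simp: conn_def)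
  have edge: "\<exists>n. P n \<inter> {u} \<noteq> {} \<and> P n \<inter> S \<noteq> {}" if "\<exists>n. u \<in> P n \<and> v \<in> P n" "v \<in> S"
    for P :: "'b \<Rightarrow> 'a set" and u v S
    using that by blast
  have cover: "(u, v) \<in> E \<Longrightarrow> \<exists>n. u \<in> W n \<and> v \<in> W n" for u v
    using fd unfolding forest_dec_def by blast
  have "(a, b) \<in> E" "(b, c) \<in> E" using xs(3)[of 0] xs(3)[of 1] eq by simp_all
  moreover have "(last (c # ys), a) \<in> E"
    using xs(3)[of "length xs - 1"] last_conv_nth[of xs] eq by auto
  then have "(a, last (c # ys)) \<in> E" using \<open>sym E\<close> by (simp add: symD)
  ultimately obtain n where n: "W n \<inter> {a} \<noteq> {}" "W n \<inter> {b} \<noteq> {}" "W n \<inter> set (c # ys) \<noteq> {}"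
    using forest_dec_Helly[OF fd single[of a] single[of b] conn_set[OF \<open>sym E\<close> succ]
        edge[OF cover, of a b] edge[OF cover, of b c] edge[OF cover, of a "last (c # ys)"]]
      last_in_set[of "c # ys"] by (metis list.discI list.set_intros(1) singletonI)
  then obtain d where "{a, b, d} \<subseteq> W n" "d \<in> set (c # ys)" by blast
  moreover from this(2) have "card {a, b, d} = 3" using xs(1) eq by (auto simp: card_insert_if)
  ultimately have "card (W n) \<ge> 3" using fin card_mono by metis
  then show ?thesis by (rule that)
qed

section \<open>Attaining the tree-width\<close>

lemma trivial_tree_decomposition:
  assumes "simple_graph G"
  shows "tree_decomposition G \<lparr>vertices = {t}, edges = {}\<rparr> (\<lambda>_. vertices G)"
proof -
  let ?T = "\<lparr>vertices = {t}, edges = {}\<rparr> :: 'b graph"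
  have "\<not> (is_cycle C \<and> subgraph C ?T)" for C
  proof
    assume "is_cycle C \<and> subgraph C ?T"
    then obtain xs where "distinct xs" "length xs \<ge> 3" "set xs \<subseteq> {t}"
      unfolding is_cycle_def subgraph_def by auto
    then have "length xs \<le> card {t}" by (metis card_mono distinct_card finite.emptyI finite.insertI)
    with \<open>length xs \<ge> 3\<close> show False by simp
  qed
  then have "forest ?T" by (auto simp: forest_def simple_graph_def)
  moreover have "path_between ?T t [t] t" by (simp add: path_between_def)
  then have "connected_graph ?T" unfolding connected_graph_def by auto
  moreover have "\<forall>e\<in>edges G. e \<subseteq> vertices G" using assms by (fastforce simp: simple_graph_def)
  ultimately show ?thesis unfolding tree_decomposition_def tree_def by auto
qed

text \<open>Widths are at least -1 and the one-node tree realises one, so the \<open>LEAST\<close>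
  is attained. The parts have bounded size, so the maximum in \<open>width\<close> is over a finite
  set even if the tree is infinite.\<close>

lemma tree_width_attained:
  assumes "simple_graph G" "finite (vertices G)"
  obtains T :: "nat graph" and W where "tree_decomposition G T W" "width T W = tree_width G"
    "\<And>t. t \<in> vertices T \<Longrightarrow> finite (W t) \<and> int (card (W t)) \<le> tree_width G + 1"
proof -
  define Q where "Q w \<longleftrightarrow> (\<exists>(T :: nat graph) W. tree_decomposition G T W \<and> w = width T W)" for w
  have part: "finite (W t) \<and> 0 \<le> int (card (W t)) \<and> int (card (W t)) \<le> width T W + 1"
    if td: "tree_decomposition G T W" and t: "t \<in> vertices T" for T :: "nat graph" and W t
  proof -
    have sub: "W s \<subseteq> vertices G" if "s \<in> vertices T" for s
    proof -
      have "vertices G = (\<Union>t\<in>vertices T. W t)" using td by (simp only: tree_decomposition_def)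
      then show ?thesis using that by blast
    qed
    then have "card (W s) \<le> card (vertices G)" if "s \<in> vertices T" for s
      using card_mono[OF assms(2)] that by blast
    then have "(\<lambda>t. int (card (W t))) ` vertices T \<subseteq> {0..int (card (vertices G))}" by auto
    then have "finite ((\<lambda>t. int (card (W t))) ` vertices T)" by (rule finite_subset) simp
    then have "int (card (W t)) \<le> width T W + 1" unfolding width_def using t by simp
    then show ?thesis using finite_subset[OF sub[OF t] assms(2)] by simp
  qed
  have bound: "w \<ge> -1" if "Q w" for w
  proof -
    obtain T :: "nat graph" and W where w: "tree_decomposition G T W" "w = width T W"
      using \<open>Q w\<close> unfolding Q_def by blast
    have "tree T" using w(1) by (simp only: tree_decomposition_def)
    then obtain t where "t \<in> vertices T" unfolding tree_def connected_graph_def by blast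
    then have "0 \<le> width T W + 1" using part[OF w(1)] by force
    then show ?thesis using w(2) by simp
  qed
  have "Q (width \<lparr>vertices = {0 :: nat}, edges = {}\<rparr> (\<lambda>_. vertices G))"
    unfolding Q_def by (intro exI conjI, rule trivial_tree_decomposition[OF assms(1)], rule refl)
  \<comment> \<open>Adding 1 makes the widths non-negative, so a least one can be found among the
    natural numbers.\<close>
  from ex_has_least_nat[of Q, OF this, of "\<lambda>w. nat (w + 1)"]
  obtain w where *: "Q w \<and> (\<forall>w'. Q w' \<longrightarrow> nat (w + 1) \<le> nat (w' + 1))" ..
  then have w: "Q w" "\<And>w'. Q w' \<Longrightarrow> nat (w + 1) \<le> nat (w' + 1)" by simp_all
  have "tree_width G = w" unfolding tree_width_def Q_def[symmetric]
  proof (rule Least_equality[of Q w, OF w(1)])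
    fix w' assume "Q w'"
    then show "w \<le> w'" using w(2)[of w'] bound[of w'] bound[OF w(1)] by linarith
  qed
  moreover obtain T :: "nat graph" and W where TW: "tree_decomposition G T W" "w = width T W"
    using w(1) unfolding Q_def by blast
  ultimately have eq: "width T W = tree_width G" by simp
  show ?thesis
  proof (rule that[OF TW(1) eq])
    fix t assume "t \<in> vertices T"
    then show "finite (W t) \<and> int (card (W t)) \<le> tree_width G + 1" using part[OF TW(1)] eq by simp
  qed
qed

theorem corollary6p2:
  fixes G :: "'a graph" and k l :: nat
  assumes "simple_graph G"
    and "finite (vertices G)"
    and "tree_width G < int k"
    and "\<not> (\<exists>C. geodesic_cycle C G \<and> cycle_length C > l)"
    and "\<not> forest G"
  shows "hyperbolic (of_int \<lfloor>3 / 2 * real l * (real k - 2)\<rfloor>) G"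
proof -
  obtain T :: "nat graph" and W where td: "tree_decomposition G T W"
    and W: "\<And>t. t \<in> vertices T \<Longrightarrow> finite (W t) \<and> int (card (W t)) \<le> tree_width G + 1"
    using tree_width_attained[OF assms(1,2)] by metis
  define W' where "W' t = (if t \<in> vertices T then W t else {})" for t
  have fd: "forest_dec (vertices G) (adj G) (adj T) W'"
    using tree_decomposition_forest_dec[OF td] by (simp add: W'_def[abs_def])
  have W': "finite (W' t)" "card (W' t) \<le> k" for t
    using W[of t] assms(3) by (auto simp: W'_def)
  obtain xs where xs: "distinct xs" "length xs \<ge> 3"
      "\<And>i. i < length xs \<Longrightarrow> (xs ! i, xs ! (Suc i mod length xs)) \<in> adj G"
    using not_forest_cycle[OF assms(1,5)] by metis
  obtain n where "card (W' n) \<ge> 3"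
    using forest_dec_cycle_part[OF fd sym_adj xs(1,2)] xs(3) W'(1) by metis
  then have k: "k \<ge> 3" using W'(2)[of n] by simp
  have short: "cycle_length C \<le> l" if "geodesic_cycle C G" for C
    using assms(4) that by (meson not_le)
  \<comment> \<open>A geodesic cycle has at least three edges, so \<open>l \<ge> 3\<close> and
    adjacent vertices are near.\<close>
  obtain C where "geodesic_cycle C G" "cycle_length C \<ge> 3"
    using geodesic_cycle_exists[OF assms(1) xs(1,2)] xs(3) by metis
  then have l: "l div 2 \<ge> 1" using short[of C] by linarith
  have exact: "locally_exact (adj G) (l div 2)"
    by (rule locally_exact_adj[OF assms(1)]) (rule short)
  define m where "m = l div 2"
  show ?thesis
  proof (rule hyperbolic_if_forest_dec[OF assms(1)])
    show "forest_dec (vertices G) (adj G) (refined_rel (adj G) m (adj T) W') (refined_part (adj G) m W')"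
      using forest_dec_refined[OF fd sym_adj] l exact unfolding m_def by blast
    show "(u, v) \<in> ((adj G)\<^sup>=) ^^ (m * (k - 1))"
      if "u \<in> refined_part (adj G) m W' q" "v \<in> refined_part (adj G) m W' q" for q u v
    proof -
      obtain t Y where "q = (t, Y)" by (metis surj_pair)
      then show ?thesis
        using refined_part_diameter[where W = W' and t = t, OF sym_adj W'] that by blast
    qed
    \<comment> \<open>The estimate uses \<open>2 * m \<le> l\<close> and, since
      \<open>k \<ge> 3\<close>, also \<open>k - 1 \<le> 2 * (k - 2)\<close>.\<close>
    fix d :: nat assume "2 * d \<le> 3 * (m * (k - 1))"
    then have "4 * d \<le> 3 * (2 * m * (k - 1))" by simp
    also have "\<dots> \<le> 3 * (l * (2 * (k - 2)))"
      using k by (intro mult_le_mono) (auto simp: m_def)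
    finally have "2 * d \<le> 3 * (l * (k - 2))" by simp
    then have "real (2 * d) \<le> real (3 * (l * (k - 2)))" by (rule of_nat_mono)
    then have "of_int (int d) \<le> 3 / 2 * real l * (real k - 2)" using k by (simp add: of_nat_diff algebra_simps)
    then have "int d \<le> \<lfloor>3 / 2 * real l * (real k - 2)\<rfloor>" by (simp only: le_floor_iff)
    then show "real d \<le> of_int \<lfloor>3 / 2 * real l * (real k - 2)\<rfloor>" by linarith
  qed
qed

end
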